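(* For all $m,n\in\mathbb{Z}_{\ge0}$ the following identities hold in the quantum cluster algebra $\mathcal{A}_q(Q)$ of type $A_2^{(1)}$ with principal coefficients (empty sums are $0$). (1) When $m$ is odd: (i) $X_mX_{m+2n+3}=X_{m+n+1}X_{m+n+2}+q^{\frac{5m-5}{4}}y_1(y_1y_2y_3)^{\frac{m-1}{2}}\sum_{l=0}^{\lfloor n/2\rfloor}\Big(\sum_{i=0}^{l}q^{\frac{2i-1+3l}{2}}\Big)u_{n-2l}(y_1y_2y_3)^l+q^{\frac{5m-5}{4}}y_1y_2(y_1y_2y_3)^{\frac{m-1}{2}}\sum_{l=0}^{\lfloor (n-1)/2\rfloor}\Big(\sum_{i=0}^{l}q^{\frac{2i+3l}{2}}\Big)u_{n-1-2l}(y_1y_2y_3)^l$; (ii) $X_mX_{m+2n}=X_{m+2\lfloor n/2\rfloor}X_{m+2\lceil n/2\rceil}+q^{\frac{5m-5}{4}}y_1w(y_1y_2y_3)^{\frac{m-1}{2}}\sum_{l=0}^{\lfloor (n-2)/2\rfloor}\Big(\sum_{i=0}^{l}q^{\frac{2i-1+3l}{2}}\Big)u_{n-2-2l}(y_1y_2y_3)^l$; (iii) $X_{-m}X_{-(m+2n+3)}=X_{-(m+n+1)}X_{-(m+n+2)}+q^{\frac{m-1}{4}}y_2y_3(y_1y_2y_3)^{\frac{m-1}{2}}\sum_{l=0}^{\lfloor n/2\rfloor}\Big(\sum_{i=0}^{l}q^{\frac{2i+2+l}{2}}\Big)u_{n-2l}(y_1y_2y_3)^l+q^{\frac{m-1}{4}}y_3(y_1y_2y_3)^{\frac{m+1}{2}}\sum_{l=0}^{\lfloor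 (n-1)/2\rfloor}\Big(\sum_{i=0}^{l}q^{\frac{2i+2+l}{2}}\Big)u_{n-1-2l}(y_1y_2y_3)^l$; (iv) $X_{-m}X_{-(m+2n)}=X_{-(m+2\lfloor n/2\rfloor)}X_{-(m+2\lceil n/2\rceil)}+q^{\frac{m-1}{4}}w\,y_2y_3(y_1y_2y_3)^{\frac{m-1}{2}}\sum_{l=0}^{\lfloor (n-2)/2\rfloor}\Big(\sum_{i=0}^{l}q^{\frac{2i+2+l}{2}}\Big)u_{n-2-2l}(y_1y_2y_3)^l$. (2) When $m$ is even: (i) for $m>0$, $X_mX_{m+2n+3}=X_{m+n+1}X_{m+n+2}+q^{\frac{5m-10}{4}}y_1y_2(y_1y_2y_3)^{\frac{m-2}{2}}\sum_{l=0}^{\lfloor n/2\rfloor}\Big(\sum_{i=0}^{l}q^{\frac{2i+3l}{2}}\Big)u_{n-2l}(y_1y_2y_3)^l+q^{\frac{5m}{4}}y_1(y_1y_2y_3)^{\frac m2}\sum_{l=0}^{\lfloor (n-1)/2\rfloor}\Big(\sum_{i=0}^{l}q^{\frac{2i-1+3l}{2}}\Big)u_{n-1-2l}(y_1y_2y_3)^l$; (ii) for $m>0$, $X_mX_{m+2n}=X_{m+2\lfloor n/2\rfloor}X_{m+2\lceil n/2\rceil}+q^{\frac{5m-10}{4}}y_1y_2z(y_1y_2y_3)^{\frac{m-2}{2}}\sum_{l=0}^{\lfloor (n-2)/2\rfloor}\Big(\sum_{i=0}^{l}q^{\frac{2i+3l}{2}}\Big)u_{n-2-2l}(y_1y_2y_3)^l$;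 (iii) $X_{-m}X_{-(m+2n+3)}=X_{-(m+n+1)}X_{-(m+n+2)}+q^{\frac{m-2}{4}}y_3(y_1y_2y_3)^{\frac m2}\sum_{l=0}^{\lfloor n/2\rfloor}\Big(\sum_{i=0}^{l}q^{\frac{2i+2+l}{2}}\Big)u_{n-2l}(y_1y_2y_3)^l+q^{\frac{m-2}{4}}y_2y_3(y_1y_2y_3)^{\frac m2}\sum_{l=0}^{\lfloor (n-1)/2\rfloor}\Big(\sum_{i=0}^{l}q^{\frac{2i+3+l}{2}}\Big)u_{n-1-2l}(y_1y_2y_3)^l$; (iv) $X_{-m}X_{-(m+2n)}=X_{-(m+2\lfloor n/2\rfloor)}X_{-(m+2\lceil n/2\rceil)}+q^{\frac{m-2}{4}}z\,y_3(y_1y_2y_3)^{\frac m2}\sum_{l=0}^{\lfloor (n-2)/2\rfloor}\Big(\sum_{i=0}^{l}q^{\frac{2i+2+l}{2}}\Big)u_{n-2-2l}(y_1y_2y_3)^l$.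
   Context: Quantum torus. Let $q$ be a formal parameter and let $\Lambda$ be the skew-symmetric bilinear form on $\mathbb{Z}^6$ (standard basis $\mathbf e_1,\dots,\mathbf e_6$) with $\Lambda(\mathbf e_i,\mathbf e_j)=\lambda_{ij}$, where $$(\lambda_{ij})=\begin{pmatrix}0&0&0&-1&0&0\\0&0&0&0&-1&0\\0&0&0&0&0&-1\\1&0&0&0&-1&-1\\0&1&0&1&0&-1\\0&0&1&1&1&0\end{pmatrix},\qquad \widetilde B=\begin{pmatrix}0&1&1\\-1&0&1\\-1&-1&0\\1&0&0\\0&1&0\\0&0&1\end{pmatrix}.$$ The based quantum torus $\mathcal T$ is the $\mathbb{Z}[q^{\pm 1/2}]$-algebra with $\mathbb{Z}[q^{\pm 1/2}]$-basis $\{X^{\mathbf c}:\mathbf c\in\mathbb{Z}^6\}$ and multiplication $X^{\mathbf c}X^{\mathbf d}=q^{\Lambda(\mathbf c,\mathbf d)/2}X^{\mathbf c+\mathbf d}$; $\mathcal F$ is its skew-field of fractions. Put $X_i=X^{\mathbf e_i}$ for $i=1,2,3$ and $y_1=X^{\mathbf e_4}$, $y_2=X^{\mathbf e_5}$, $y_3=X^{\mathbf e_6}$ (these do not commute; products are ordered as written). Seeds and mutation. A quantum seed is a triple $(\Lambda',\widetilde B',X')$ with $X'=(X_1',\dots,X_6')$ in $\mathcal F$, where $(X')^{\mathbf c}:=q^{-\frac12\sum_{i<j}c_ic_j\lambda'_{ij}}(X_1')^{c_1}\cdots (X_6')^{c_6}$. The mutation in direction $k\in\{1,2,3\}$ replaces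 $\Lambda'$ by $E^T\Lambda' E$, where $E=(e_{ij})$ has $e_{ij}=\delta_{ij}$ for $j\ne k$, $e_{kk}=-1$, $e_{ik}=[-b'_{ik}]_+$ for $i\ne k$ ($[a]_+=\max(a,0)$); replaces $b'_{ij}$ by $-b'_{ij}$ if $i=k$ or $j=k$, and by $b'_{ij}+\frac12(|b'_{ik}|b'_{kj}+b'_{ik}|b'_{kj}|)$ otherwise; and replaces $X'_k$ by $(X')^{-\mathbf e_k+\sum_i[b'_{ik}]_+\mathbf e_i}+(X')^{-\mathbf e_k+\sum_i[-b'_{ik}]_+\mathbf e_i}$, leaving the other $X'_j$ unchanged. The initial seed is $\Sigma_1=(\Lambda,\widetilde B,(X_1,X_2,X_3,y_1,y_2,y_3))$; $\mathcal A_q(Q)\subset\mathcal F$ is generated, over Laurent polynomials in $y_1,y_2,y_3$ with coefficients in $\mathbb{Z}[q^{\pm1/2}]$, by all quantum cluster variables (first three entries of $X'$ in seeds obtained from $\Sigma_1$ by finitely many mutations). Variables $X_m$, $m\in\mathbb{Z}$. The seed $\Sigma_m$ has cluster $(X_m,X_{m+1},X_{m+2})$: mutating $\Sigma_m$ in direction 1 replaces $X_m$ by $X_{m+3}$ and, after reordering the first three indices to $(X_{m+1},X_{m+2},X_{m+3})$, gives $\Sigma_{m+1}$; mutating $\Sigma_m$ in direction 3 replaces $X_{m+2}$ by $X_{m-1}$ and, after reordering to $(X_{m-1},X_m,X_{m+1})$, gives $\Sigma_{m-1}$. Elements $w,z,u_n$: $w=X^{(1,-1,0,0,1,0)}+X^{(0,-1,1,0,0,0)}$,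 $z=X^{(0,1,-1,1,0,1)}+X^{(-1,0,-1,1,0,0)}+X^{(-1,1,0,0,0,0)}$; $u_0=1$, $u_1=wz-q^{-1/2}X^{(0,0,0,1,0,1)}-q^{1/2}X^{(0,0,0,0,1,0)}$, $u_2=u_1^2-2X^{(0,0,0,1,1,1)}$, $u_{n+1}=u_1u_n-X^{(0,0,0,1,1,1)}u_{n-1}$ for $n\ge2$. *)

theory Defs
  imports "HOL-Analysis.Analysis" "HOL-Library.Poly_Mapping"
begin

text \<open>Coordinates of \<open>\<int>\<^sup>6\<close> are \<open>1, \<dots>, 6\<close> in the index type \<open>6\<close> (where \<open>6 = 0\<close>: the order of that
  type is therefore never used, ordered sums and products are written with explicit ranges).\<close>

definition Lambda0 :: "int ^ 6 ^ 6" where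
  "Lambda0 = vector [
     vector [0, 0, 0, -1,  0,  0],
     vector [0, 0, 0,  0, -1,  0],
     vector [0, 0, 0,  0,  0, -1],
     vector [1, 0, 0,  0, -1, -1],
     vector [0, 1, 0,  1,  0, -1],
     vector [0, 0, 1,  1,  1,  0]]"

definition B0 :: "int ^ 3 ^ 6" where
  "B0 = vector [
     vector [ 0,  1, 1],
     vector [-1,  0, 1],
     vector [-1, -1, 0],
     vector [ 1,  0, 0],
     vector [ 0,  1, 0],
     vector [ 0,  0, 1]]"

definition Lam :: "int ^ 6 \<Rightarrow> int ^ 6 \<Rightarrow> int" where
  "Lam c d = (\<Sum>i\<in>UNIV. \<Sum>j\<in>UNIV. c $ i * Lambda0 $ i $ j * d $ j)"

text \<open>Laurent polynomials over \<open>\<int>\<close> in \<open>q\<^bsup>1/2\<^esup>\<close>; \<open>q\<^bsup>k/2\<^esup>\<close> is \<open>Poly_Mapping.single k 1\<close>.\<close>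

type_synonym qlaurent = "int \<Rightarrow>\<^sub>0 int"

text \<open>An element of the torus is its family of coefficients with respect to the basis \<open>X\<^sup>c\<close>.\<close>

typedef qtorus = "UNIV :: ((int ^ 6) \<Rightarrow>\<^sub>0 qlaurent) set"
  morphisms tcoeffs Torus ..

setup_lifting type_definition_qtorus

definition torus_mult ::
  "((int ^ 6) \<Rightarrow>\<^sub>0 qlaurent) \<Rightarrow> ((int ^ 6) \<Rightarrow>\<^sub>0 qlaurent) \<Rightarrow> ((int ^ 6) \<Rightarrow>\<^sub>0 qlaurent)" where
  "torus_mult a b =
     (\<Sum>c\<in>Poly_Mapping.keys a. \<Sum>d\<in>Poly_Mapping.keys b.
        Poly_Mapping.single (c + d)
          (Poly_Mapping.single (Lam c d) 1 * Poly_Mapping.lookup a c * Poly_Mapping.lookup b d))"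

lemma torus_mult_superset:
  assumes "finite A" "finite B" "Poly_Mapping.keys a \<subseteq> A" "Poly_Mapping.keys b \<subseteq> B"
  shows "torus_mult a b = (\<Sum>c\<in>A. \<Sum>d\<in>B. Poly_Mapping.single (c + d)
          (Poly_Mapping.single (Lam c d) 1 * Poly_Mapping.lookup a c * Poly_Mapping.lookup b d))"
proof -
  have "(\<Sum>d\<in>Poly_Mapping.keys b. Poly_Mapping.single (c + d)
          (Poly_Mapping.single (Lam c d) 1 * Poly_Mapping.lookup a c * Poly_Mapping.lookup b d))
      = (\<Sum>d\<in>B. Poly_Mapping.single (c + d)
          (Poly_Mapping.single (Lam c d) 1 * Poly_Mapping.lookup a c * Poly_Mapping.lookup b d))" for c
    by (rule sum.mono_neutral_left) (use assms in \<open>auto simp: in_keys_iff\<close>)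
  then have "torus_mult a b = (\<Sum>c\<in>Poly_Mapping.keys a. \<Sum>d\<in>B. Poly_Mapping.single (c + d)
          (Poly_Mapping.single (Lam c d) 1 * Poly_Mapping.lookup a c * Poly_Mapping.lookup b d))"
    by (simp add: torus_mult_def)
  also have "\<dots> = (\<Sum>c\<in>A. \<Sum>d\<in>B. Poly_Mapping.single (c + d)
          (Poly_Mapping.single (Lam c d) 1 * Poly_Mapping.lookup a c * Poly_Mapping.lookup b d))"
    by (rule sum.mono_neutral_left) (use assms in \<open>auto simp: in_keys_iff\<close>)
  finally show ?thesis .
qed

lemma torus_mult_add_left: "torus_mult (a + b) c = torus_mult a c + torus_mult b c"
proof -
  let ?A = "Poly_Mapping.keys a \<union> Poly_Mapping.keys b" and ?B = "Poly_Mapping.keys c"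
  have *: "finite ?A" "finite ?B" "Poly_Mapping.keys (a + b) \<subseteq> ?A"
    using keys_add[of a b] by auto
  show ?thesis
    by (subst (1 2 3) torus_mult_superset[where A = ?A and B = ?B])
       (use * in \<open>auto simp: lookup_add algebra_simps single_add sum.distrib\<close>)
qed

lemma torus_mult_add_right: "torus_mult c (a + b) = torus_mult c a + torus_mult c b"
proof -
  let ?A = "Poly_Mapping.keys a \<union> Poly_Mapping.keys b" and ?B = "Poly_Mapping.keys c"
  have *: "finite ?A" "finite ?B" "Poly_Mapping.keys (a + b) \<subseteq> ?A"
    using keys_add[of a b] by auto
  show ?thesis
    by (subst (1 2 3) torus_mult_superset[where A = ?B and B = ?A])
       (use * in \<open>auto simp: lookup_add algebra_simps single_add sum.distrib\<close>)
qed

lemma torus_mult_single: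
  "torus_mult (Poly_Mapping.single c p) (Poly_Mapping.single d r) =
     Poly_Mapping.single (c + d) (Poly_Mapping.single (Lam c d) 1 * p * r)"
  by (subst torus_mult_superset[where A = "{c}" and B = "{d}"]) auto

lemma torus_coeff_induct [case_names single add]:
  fixes a :: "'a \<Rightarrow>\<^sub>0 'b::comm_monoid_add"
  assumes single: "\<And>c p. P (Poly_Mapping.single c p)"
    and add: "\<And>a b. P a \<Longrightarrow> P b \<Longrightarrow> P (a + b)"
  shows "P a"
proof -
  have expand: "a = (\<Sum>c\<in>Poly_Mapping.keys a. Poly_Mapping.single c (Poly_Mapping.lookup a c))"
    by (rule poly_mapping_eqI) (auto simp: lookup_sum lookup_single when_def in_keys_iff)
  have zero: "P 0"
    using single[of undefined 0] by simp
  have "P (\<Sum>c\<in>A. Poly_Mapping.single c (Poly_Mapping.lookup a c))" if "finite A" for A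
    using that by (induction A) (auto simp: zero single add)
  from this[OF finite_keys[of a]] show ?thesis
    using expand by simp
qed

lemma Lam_add_left: "Lam (a + b) c = Lam a c + Lam b c"
  and Lam_add_right: "Lam c (a + b) = Lam c a + Lam c b"
  by (simp_all add: Lam_def algebra_simps sum.distrib)

lemma Lam_zero [simp]: "Lam 0 c = 0" "Lam c 0 = 0"
  by (simp_all add: Lam_def)

lemma torus_mult_assoc: "torus_mult (torus_mult a b) c = torus_mult a (torus_mult b c)"
proof (induction a rule: torus_coeff_induct)
  case (single x p)
  have Q: "Poly_Mapping.single (k + l) (1::int) = Poly_Mapping.single k 1 * Poly_Mapping.single l 1"
    for k l :: int
    by (simp add: mult_single)
  show ?case
  proof (induction b rule: torus_coeff_induct)
    case (single y r)
    show ?case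
    proof (induction c rule: torus_coeff_induct)
      case (single v s)
      show ?case
        by (simp add: torus_mult_single Lam_add_left Lam_add_right Q ac_simps)
    qed (simp add: torus_mult_add_right)
  qed (simp add: torus_mult_add_left torus_mult_add_right)
qed (simp add: torus_mult_add_left)

lemma torus_mult_one: "torus_mult 1 a = a" "torus_mult a 1 = a"
proof -
  have "torus_mult (Poly_Mapping.single 0 1) a = a" "torus_mult a (Poly_Mapping.single 0 1) = a"
  proof (induction a rule: torus_coeff_induct)
    case (single c p)
    show "torus_mult (Poly_Mapping.single 0 1) (Poly_Mapping.single c p) = Poly_Mapping.single c p"
      "torus_mult (Poly_Mapping.single c p) (Poly_Mapping.single 0 1) = Poly_Mapping.single c p"
      by (subst torus_mult_single, simp)+
  qed (simp_all only: torus_mult_add_left torus_mult_add_right)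
  then show "torus_mult 1 a = a" "torus_mult a 1 = a"
    by simp_all
qed

instantiation qtorus :: ring_1
begin

lift_definition zero_qtorus :: qtorus is 0 .
lift_definition one_qtorus :: qtorus is 1 .
lift_definition plus_qtorus :: "qtorus \<Rightarrow> qtorus \<Rightarrow> qtorus" is "(+)" .
lift_definition minus_qtorus :: "qtorus \<Rightarrow> qtorus \<Rightarrow> qtorus" is "(-)" .
lift_definition uminus_qtorus :: "qtorus \<Rightarrow> qtorus" is uminus .
lift_definition times_qtorus :: "qtorus \<Rightarrow> qtorus \<Rightarrow> qtorus" is torus_mult .

instance
proof
  show "(0::qtorus) \<noteq> 1"
    by transfer simp
qed (transfer; simp add: torus_mult_assoc torus_mult_one torus_mult_add_left torus_mult_add_right)+

end

text \<open>\<open>qX k c\<close> is \<open>q\<^bsup>k/2\<^esup> X\<^sup>c\<close>.\<close>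

definition qX :: "int \<Rightarrow> int ^ 6 \<Rightarrow> qtorus" where
  "qX k c = Torus (Poly_Mapping.single c (Poly_Mapping.single k 1))"

lemma qX_mult: "qX k c * qX l d = qX (k + l + Lam c d) (c + d)"
  unfolding qX_def
  by (simp add: times_qtorus.abs_eq eq_onp_def torus_mult_single mult_single add_ac)

definition qhalf :: qtorus where
  "qhalf = qX 1 0"

text \<open>A ring homomorphism \<open>\<iota>\<close> exhibiting the division ring \<open>'f\<close> as the skew-field of fractions of the
  torus.  Since the torus is an Ore domain, such a pair exists and is unique up to unique isomorphism.\<close>

definition is_skew_fraction_field :: "(qtorus \<Rightarrow> 'f::division_ring) \<Rightarrow> bool" where
  "is_skew_fraction_field \<iota> \<longleftrightarrow>
     \<iota> 1 = 1 \<and>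
     (\<forall>a b. \<iota> (a + b) = \<iota> a + \<iota> b) \<and>
     (\<forall>a b. \<iota> (a * b) = \<iota> a * \<iota> b) \<and>
     inj \<iota> \<and>
     (\<forall>f. \<exists>a b. b \<noteq> 0 \<and> f = \<iota> a * inverse (\<iota> b))"

record 'f qseed =
  seed_lam :: "int ^ 6 ^ 6"
  seed_b :: "int ^ 3 ^ 6"
  seed_X :: "'f ^ 6"

text \<open>The row index, in type \<open>6\<close>, of the column \<open>k\<close> of the exchange matrix.\<close>

definition row3 :: "3 \<Rightarrow> 6" where
  "row3 k = (if k = 1 then 1 else if k = 2 then 2 else 3)"

text \<open>\<open>(X')\<^sup>c\<close>; the first argument is \<open>q\<^bsup>1/2\<^esup>\<close> as an element of the skew-field.\<close>

definition frame :: "'f::division_ring \<Rightarrow> 'f qseed \<Rightarrow> int ^ 6 \<Rightarrow> 'f" where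
  "frame h S c =
     h powi (- (\<Sum>i = 1..6. \<Sum>j = i + 1..6.
                  c $ of_nat i * c $ of_nat j * seed_lam S $ of_nat i $ of_nat j))
     * (seed_X S $ 1 powi c $ 1) * (seed_X S $ 2 powi c $ 2) * (seed_X S $ 3 powi c $ 3)
     * (seed_X S $ 4 powi c $ 4) * (seed_X S $ 5 powi c $ 5) * (seed_X S $ 6 powi c $ 6)"

definition mut_E :: "int ^ 3 ^ 6 \<Rightarrow> 3 \<Rightarrow> int ^ 6 ^ 6" where
  "mut_E B k = (\<chi> i j.
     if j \<noteq> row3 k then (if i = j then 1 else 0)
     else if i = row3 k then -1
     else max (- (B $ i $ k)) 0)"

text \<open>The division by 2 is exact.\<close>

definition mut_b :: "int ^ 3 ^ 6 \<Rightarrow> 3 \<Rightarrow> int ^ 3 ^ 6" where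
  "mut_b B k = (\<chi> i j.
     if i = row3 k \<or> j = k then - (B $ i $ j)
     else B $ i $ j
       + (\<bar>B $ i $ k\<bar> * B $ row3 k $ j + B $ i $ k * \<bar>B $ row3 k $ j\<bar>) div 2)"

definition mutate :: "'f::division_ring \<Rightarrow> 3 \<Rightarrow> 'f qseed \<Rightarrow> 'f qseed" where
  "mutate h k S = \<lparr>
     seed_lam = transpose (mut_E (seed_b S) k) ** seed_lam S ** mut_E (seed_b S) k,
     seed_b = mut_b (seed_b S) k,
     seed_X = (\<chi> j.
       if j = row3 k
       then frame h S ((\<chi> i. max (seed_b S $ i $ k) 0) - axis (row3 k) 1)
          + frame h S ((\<chi> i. max (- (seed_b S $ i $ k)) 0) - axis (row3 k) 1)
       else seed_X S $ j) \<rparr>"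

definition initial_seed :: "(qtorus \<Rightarrow> 'f::division_ring) \<Rightarrow> 'f qseed" where
  "initial_seed \<iota> =
     \<lparr> seed_lam = Lambda0, seed_b = B0, seed_X = (\<chi> i. \<iota> (qX 0 (axis i 1))) \<rparr>"

inductive mutation_reachable :: "(qtorus \<Rightarrow> 'f::division_ring) \<Rightarrow> 'f qseed \<Rightarrow> bool"
  for \<iota> where
  initial: "mutation_reachable \<iota> (initial_seed \<iota>)"
| mutate: "mutation_reachable \<iota> S \<Longrightarrow> mutation_reachable \<iota> (mutate (\<iota> qhalf) k S)"

definition yvar :: "(qtorus \<Rightarrow> 'f::division_ring) \<Rightarrow> 3 \<Rightarrow> 'f" where
  "yvar \<iota> i = \<iota> (qX 0 (axis (3 + row3 i) 1))"

text \<open>\<open>\<A>\<^sub>q(Q)\<close>: being generated over the Laurent polynomials in the \<open>y\<^sub>i\<close> with coefficients in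
  \<open>\<int>[q\<^bsup>\<plusminus>1/2\<^esup>]\<close> means being generated as a ring once the units \<open>q\<^bsup>1/2\<^esup>\<close> and \<open>y\<^sub>i\<close> and their inverses
  are added to the generators.\<close>

inductive_set quantum_cluster_algebra :: "(qtorus \<Rightarrow> 'f::division_ring) \<Rightarrow> 'f set"
  for \<iota> where
  one: "1 \<in> quantum_cluster_algebra \<iota>"
| q_half: "\<iota> qhalf \<in> quantum_cluster_algebra \<iota>"
| q_half_inv: "inverse (\<iota> qhalf) \<in> quantum_cluster_algebra \<iota>"
| y: "yvar \<iota> i \<in> quantum_cluster_algebra \<iota>"
| y_inv: "inverse (yvar \<iota> i) \<in> quantum_cluster_algebra \<iota>"
| cluster: "mutation_reachable \<iota> S \<Longrightarrow> seed_X S $ row3 k \<in> quantum_cluster_algebra \<iota>"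
| diff: "a \<in> quantum_cluster_algebra \<iota> \<Longrightarrow> b \<in> quantum_cluster_algebra \<iota> \<Longrightarrow>
    a - b \<in> quantum_cluster_algebra \<iota>"
| mult: "a \<in> quantum_cluster_algebra \<iota> \<Longrightarrow> b \<in> quantum_cluster_algebra \<iota> \<Longrightarrow>
    a * b \<in> quantum_cluster_algebra \<iota>"

text \<open>Reordering of the three mutable indices: position \<open>j\<close> of the new seed is position \<open>p j\<close> of the
  old one.\<close>

definition row_perm :: "(3 \<Rightarrow> 3) \<Rightarrow> 6 \<Rightarrow> 6" where
  "row_perm p i =
     (if i = 1 then row3 (p 1) else if i = 2 then row3 (p 2) else if i = 3 then row3 (p 3) else i)"

definition reorder :: "(3 \<Rightarrow> 3) \<Rightarrow> 'f qseed \<Rightarrow> 'f qseed" where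
  "reorder p S = \<lparr>
     seed_lam = (\<chi> i j. seed_lam S $ row_perm p i $ row_perm p j),
     seed_b = (\<chi> i j. seed_b S $ row_perm p i $ p j),
     seed_X = (\<chi> i. seed_X S $ row_perm p i) \<rparr>"

text \<open>Arithmetic in the index type \<open>3\<close> is modulo 3, so \<open>j \<mapsto> j + 1\<close> and \<open>j \<mapsto> j - 1\<close> are the two cyclic
  reorderings.\<close>

definition seed_next :: "'f::division_ring \<Rightarrow> 'f qseed \<Rightarrow> 'f qseed" where
  "seed_next h S = reorder (\<lambda>j. j + 1) (mutate h 1 S)"

definition seed_prev :: "'f::division_ring \<Rightarrow> 'f qseed \<Rightarrow> 'f qseed" where
  "seed_prev h S = reorder (\<lambda>j. j - 1) (mutate h 3 S)"

definition Sigma_seed :: "(qtorus \<Rightarrow> 'f::division_ring) \<Rightarrow> int \<Rightarrow> 'f qseed" where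
  "Sigma_seed \<iota> m =
     (if m \<ge> 1 then (seed_next (\<iota> qhalf) ^^ nat (m - 1)) (initial_seed \<iota>)
      else (seed_prev (\<iota> qhalf) ^^ nat (1 - m)) (initial_seed \<iota>))"

definition Xvar :: "(qtorus \<Rightarrow> 'f::division_ring) \<Rightarrow> int \<Rightarrow> 'f" where
  "Xvar \<iota> m = seed_X (Sigma_seed \<iota> m) $ 1"

definition w_elt :: qtorus where
  "w_elt = qX 0 (vector [1, -1, 0, 0, 1, 0]) + qX 0 (vector [0, -1, 1, 0, 0, 0])"

definition z_elt :: qtorus where
  "z_elt = qX 0 (vector [0, 1, -1, 1, 0, 1]) + qX 0 (vector [-1, 0, -1, 1, 0, 0])
     + qX 0 (vector [-1, 1, 0, 0, 0, 0])"

definition u1_elt :: qtorus where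
  "u1_elt = w_elt * z_elt - qX (-1) (vector [0, 0, 0, 1, 0, 1]) - qX 1 (vector [0, 0, 0, 0, 1, 0])"

fun u_elt :: "nat \<Rightarrow> qtorus" where
  "u_elt 0 = 1"
| "u_elt (Suc 0) = u1_elt"
| "u_elt (Suc (Suc 0)) = u1_elt ^ 2 - 2 * qX 0 (vector [0, 0, 0, 1, 1, 1])"
| "u_elt (Suc (Suc (Suc n))) =
     u1_elt * u_elt (Suc (Suc n)) - qX 0 (vector [0, 0, 0, 1, 1, 1]) * u_elt (Suc n)"

end

theory Submission
  imports Defs
begin

text \<open>
  Split the cluster variables into the two half-infinite sequences \<open>X\<^sub>1, X\<^sub>2, \<dots>\<close> and
  \<open>X\<^sub>0, X\<^sub>-\<^sub>1, \<dots>\<close>.  In each of them mutation gives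
  \<open>a\<^sub>k a\<^sub>k\<^sub>+\<^sub>3 = a\<^sub>k\<^sub>+\<^sub>1 a\<^sub>k\<^sub>+\<^sub>2 + M\<^sub>k\<close> and
  \<open>a\<^sub>k\<^sub>+\<^sub>3 a\<^sub>k = a\<^sub>k\<^sub>+\<^sub>1 a\<^sub>k\<^sub>+\<^sub>2 + M'\<^sub>k\<close> with monomials
  \<open>M\<^sub>k \<noteq> M'\<^sub>k\<close> in \<open>q\<^bsup>1/2\<^esup>\<close> and the \<open>y\<^sub>i\<close>; that these monomials differ shows that the new variable
  is nonzero.  Comparing the two relations yields linear recurrences
  \<open>a\<^sub>k p\<^sub>k = a\<^sub>k\<^sub>+\<^sub>1 + a\<^sub>k\<^sub>-\<^sub>1 c\<^sub>k\<close>, where \<open>p\<^sub>k\<close> alternates between \<open>w\<close> and \<open>z\<close>, hence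
  \<open>a\<^sub>k\<^sub>+\<^sub>4 = a\<^sub>k\<^sub>+\<^sub>2 u\<^sub>1 - a\<^sub>k V\<close> with \<open>V = X\<^bsup>(0,0,0,1,1,1)\<^esup>\<close>.  Both sides of the
  asserted identities satisfy the same recurrence in \<open>n\<close> up to a correction by some \<open>M\<^sub>j\<close>, and
  \<open>M\<^sub>k\<^sub>+\<^sub>2 = \<rho> M\<^sub>k V\<close> for a power \<open>\<rho>\<close> of \<open>q\<close> turns these corrections into the double sums.
\<close>

text \<open>The cut between X_0 and X_1 is forced by signs. Stepping forward from the initial seed,
  the lower part of the mutated column is always nonnegative; stepping backward, it is nonpositive
  from the fourth step on. In both ranges the monomial in the y_i stands alone beside a product of
  two cluster variables. The three steps in between attach it to that product instead, as in X_3 X_0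
  = 1 + q^(-1/2) X_1 X_2 y_3, and break the pattern. Hence the common scheme is a locale,
  instantiated with \<rho> = q forward and \<rho> = q^(-1) backward, and the linear relations are
  carried across the gap by separate computations. The other obstacle is that neighbouring variables
  commute with each other but not with the y_i. Every cluster variable therefore gets a weight
  recording how it passes the y_i, and the compatibility of the two matrices of a seed propagates
  weights, commutation and nonvanishing through a mutation. The inner sums over i are geometric sums
  in \<rho>; they appear because the correction monomials grow by the factor \<rho> V while the
  homogeneous recurrence does not contain \<rho>.\<close>

section \<open>Exchange sequences in an arbitrary division ring\<close>

text \<open>In the instances, \<open>c k\<close> and \<open>c' k\<close> are the same monomial in
  the y_i with different powers of q; the change happens when it moves past \<open>p\<close>, which
  is \<open>c_p\<close>. Two linear relations are assumed as a start, and the exchange relations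
  generate the others.\<close>

locale exchange_sequence =
  fixes a p c c' M M' U :: "nat \<Rightarrow> 'f::division_ring" and \<rho> V u :: 'f
  assumes nonzero: "a k \<noteq> 0"
    and comm1: "a (k + 1) * a k = a k * a (k + 1)"
    and comm2: "a (k + 2) * a k = a k * a (k + 2)"
    and exchange: "a k * a (k + 3) = a (k + 1) * a (k + 2) + M k"
    and exchange_rev: "a (k + 3) * a k = a (k + 1) * a (k + 2) + M' k"
    and M'_c: "M' k * c (k + 1) = M (k + 1)"
    and linear_0: "a 1 * p 1 = a 2 + a 0 * c 1"
    and linear_1: "a 2 * p 2 = a 3 + a 1 * c 2"
    and p_periodic: "p (k + 2) = p k"
    and c_periodic: "c (k + 2) = c k"
    and c_p: "c k * p (k + 1) = p (k + 1) * c' k"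
    and c_c': "c k * c' (k + 1) = V"
    and p_p: "p k * p (k + 1) = u + c (k + 1) + c' k"
    and M_step: "M (k + 2) = \<rho> * M k * V"
    and \<rho>_central: "\<rho> * x = x * \<rho>"
    and V_p: "V * p k = p k * V"
    and V_u: "V * u = u * V"
    and U_0: "U 0 = 1" and U_1: "U 1 = u" and U_2: "U 2 = u\<^sup>2 - 2 * V"
    and U_step: "U (k + 3) = u * U (k + 2) - V * U (k + 1)"
begin

text \<open>Multiplying the relation two indices earlier by \<open>a (i + 3)\<close> produces
  \<open>a (i + 3) * a i\<close>, whose monomial \<open>M' i\<close> is turned by
  \<open>c (i + 1)\<close> into \<open>M (i + 1)\<close>. That is the monomial of the exchange
  relation for \<open>a (i + 1) * a (i + 4)\<close>, so \<open>a (i + 1)\<close> splits off on the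
  left and cancels because it is nonzero.\<close>

lemma linear: "a (k + 1) * p (k + 1) = a (k + 2) + a k * c (k + 1)"
proof (induction k rule: nat_less_induct)
  case (1 n)
  consider "n = 0" | "n = 1" | i where "n = i + 2"
    by (metis One_nat_def add_2_eq_Suc' not0_implies_Suc)
  then show ?case
  proof cases
    case (3 i)
    have IH: "a (i + 1) * p (i + 1) = a (i + 2) + a i * c (i + 1)"
      using 1 3 by simp
    have pp: "p (i + 3) = p (i + 1)" "c (i + 3) = c (i + 1)"
      using p_periodic[of "i + 1"] c_periodic[of "i + 1"] by (simp_all add: eval_nat_numeral)
    have cm: "a (i + 3) * a (i + 1) = a (i + 1) * a (i + 3)" "a (i + 3) * a (i + 2) = a (i + 2) * a (i + 3)"
      using comm2[of "i + 1"] comm1[of "i + 2"] by (simp_all add: eval_nat_numeral)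
    have ex: "a (i + 1) * a (i + 4) = a (i + 2) * a (i + 3) + M (i + 1)"
      using exchange[of "i + 1"] by (simp add: eval_nat_numeral)
    have "a (i + 1) * (a (i + 3) * p (i + 3)) = a (i + 3) * (a (i + 1) * p (i + 1))"
      by (simp only: pp mult.assoc[symmetric] cm)
    also have "\<dots> = a (i + 2) * a (i + 3) + a (i + 3) * a i * c (i + 1)"
      by (simp only: IH distrib_left mult.assoc cm)
    also have "\<dots> = a (i + 2) * a (i + 3) + M (i + 1) + a (i + 1) * a (i + 2) * c (i + 1)"
      by (simp only: exchange_rev distrib_right M'_c) (simp only: add_ac)
    also have "\<dots> = a (i + 1) * (a (i + 4) + a (i + 2) * c (i + 3))"
      by (simp only: ex distrib_left pp mult.assoc)
    finally have "a (i + 3) * p (i + 3) = a (i + 4) + a (i + 2) * c (i + 3)"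
      using mult_left_cancel[OF nonzero] by blast
    then show ?thesis
      by (simp add: 3 eval_nat_numeral)
  qed (use linear_0 linear_1 in \<open>simp_all add: eval_nat_numeral\<close>)
qed

text \<open>Expanding \<open>a (k + 2) * p (k + 2) * p (k + 3)\<close> by \<open>p_p\<close>, and
  again by applying \<open>linear\<close> twice, gives two expressions in which the terms with
  \<open>c\<close> and \<open>c'\<close> agree; what survives of the lower neighbour is
  \<open>c (k + 1) * c' (k + 2) = V\<close>.\<close>

lemma a_recurrence: "a (k + 4) = a (k + 2) * u - a k * V"
proof -
  have c0: "c (k + 1) * c' (k + 2) = V"
    using c_c'[of "k + 1"] by (simp add: eval_nat_numeral)
  have l1: "a (k + 1) * p (k + 3) = a (k + 2) + a k * c (k + 1)"
    using linear[of k] p_periodic[of "k + 1"] by (simp add: eval_nat_numeral)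
  have l2: "a (k + 2) * p (k + 2) = a (k + 3) + a (k + 1) * c (k + 2)"
    using linear[of "k + 1"] by (simp add: eval_nat_numeral)
  have l3: "a (k + 3) * p (k + 3) = a (k + 4) + a (k + 2) * c (k + 3)"
    using linear[of "k + 2"] by (simp add: eval_nat_numeral)
  have pp: "p (k + 2) * p (k + 3) = u + c (k + 3) + c' (k + 2)"
    using p_p[of "k + 2"] by (simp add: eval_nat_numeral)
  have cp: "c (k + 2) * p (k + 3) = p (k + 3) * c' (k + 2)"
    using c_p[of "k + 2"] by (simp add: eval_nat_numeral)
  have "a (k + 2) * u + a (k + 2) * c (k + 3) + a (k + 2) * c' (k + 2)
      = a (k + 2) * p (k + 2) * p (k + 3)"
    by (simp only: mult.assoc pp distrib_left)
  also have "\<dots> = a (k + 4) + a (k + 2) * c (k + 3) + a (k + 1) * p (k + 3) * c' (k + 2)"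
    by (simp only: l2 distrib_right l3 mult.assoc cp)
  also have "\<dots> = a (k + 4) + a (k + 2) * c (k + 3) + a (k + 2) * c' (k + 2) + a k * V"
    by (simp only: l1 distrib_right mult.assoc c0) (simp only: add_ac)
  finally show ?thesis
    by (simp add: algebra_simps)
qed

text \<open>These are the ratios of the monomials \<open>M\<close>: at even arguments
  \<open>M (k + n) = M k * eps n\<close>. The zeros at odd arguments allow one recurrence to serve
  both parities.\<close>

fun eps :: "nat \<Rightarrow> 'f" where
  "eps 0 = 1"
| "eps (Suc 0) = 0"
| "eps (Suc (Suc n)) = \<rho> * eps n * V"

text \<open>The index of \<open>T\<close> is shifted by 2 against the double sums: the empty sums for \<open>n < 0\<close> become
  \<open>T 0\<close> and \<open>T 1\<close>, see \<open>T_sum\<close> below.\<close>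

fun T :: "nat \<Rightarrow> 'f" where
  "T 0 = 0"
| "T (Suc 0) = 0"
| "T (Suc (Suc n)) = T (Suc n) * u - T n * V + eps n"

text \<open>Exactly one of the two summands survives, depending on the parity of \<open>n\<close>,
  so a single correction monomial can be written uniformly as forcing terms for both
  \<open>T (n + 3)\<close> and \<open>T (n + 2)\<close>.\<close>

lemma M_eps: "M k * eps (n + 1) + M (k + 1) * eps n = M (k + n + 1)"
proof (induction n rule: eps.induct)
  case 2
  show ?case
    using M_step[of k] \<rho>_central[of "M k"] by (simp add: mult.assoc)
next
  case (3 n)
  have "M (k + Suc (Suc n) + 1) = \<rho> * M (k + n + 1) * V"
    using M_step[of "k + n + 1"] by (simp add: add_ac)
  also have "\<dots> = \<rho> * (M k * eps (n + 1)) * V + \<rho> * (M (k + 1) * eps n) * V"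
    by (simp only: 3[symmetric] distrib_left distrib_right)
  finally show ?case
    using \<rho>_central[of "M k"] \<rho>_central[of "M (k + 1)"]
    by (simp add: mult.assoc[symmetric])
qed simp

lemma eps_odd: "odd n \<Longrightarrow> eps n = 0"
  by (induction n rule: eps.induct) auto

lemma p_eps: "eps n * p k = p k * eps n"
proof (induction n rule: eps.induct)
  case (3 n)
  have "eps (Suc (Suc n)) * p k = \<rho> * (eps n * p k) * V"
    by (simp add: mult.assoc V_p)
  also have "\<dots> = p k * eps (Suc (Suc n))"
    using \<rho>_central[of "p k"] by (simp add: 3 mult.assoc[symmetric])
  finally show ?case .
qed simp_all

text \<open>The left side obeys the homogeneous recurrence of \<open>a_recurrence\<close>. The
  product of neighbours on the right misses it by \<open>M (k + n + 1)\<close>, the exchange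
  monomial of \<open>a (k + n + 1) * a (k + n + 4)\<close>, and \<open>M_eps\<close> distributes
  this defect over the two \<open>T\<close> terms. With the index started one step early, one base
  case is trivial and the other is the exchange relation.\<close>

theorem odd_product:
  "a k * a (k + 2 * n + 1) = a (k + n) * a (k + n + 1) + M k * T (n + 1) + M (k + 1) * T n"
proof (induction n rule: T.induct)
  case 2
  then show ?case using exchange[of k] by (simp add: eval_nat_numeral)
next
  case (3 n)
  let ?j = "k + n"
  have r1: "a (k + 2 * n + 5) = a (k + 2 * n + 3) * u - a (k + 2 * n + 1) * V"
    using a_recurrence[of "k + 2 * n + 1"] by (simp add: eval_nat_numeral)
  have r2: "a (?j + 2) * u = a (?j + 4) + a ?j * V"
    using a_recurrence[of ?j] by simp
  have IH0: "a k * a (k + 2 * n + 1) = a ?j * a (?j + 1) + M k * T (n + 1) + M (k + 1) * T n"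
    using 3(2) by simp
  have IH1: "a k * a (k + 2 * n + 3) = a (?j + 1) * a (?j + 2) + M k * T (n + 2) + M (k + 1) * T (n + 1)"
    using 3(1) by (simp add: eval_nat_numeral)
  have ex: "a (?j + 1) * a (?j + 4) = a (?j + 2) * a (?j + 3) + M (?j + 1)"
    using exchange[of "?j + 1"] by (simp add: eval_nat_numeral)
  have t2: "T (n + 2) = T (n + 1) * u - T n * V + eps n"
    and t3: "T (n + 3) = T (n + 2) * u - T (n + 1) * V + eps (n + 1)"
    by (simp_all add: eval_nat_numeral)
  have "a (?j + 1) * a (?j + 2) * u = a (?j + 1) * a (?j + 4) + a (?j + 1) * a ?j * V"
    by (simp only: mult.assoc r2 distrib_left)
  then have P: "a (?j + 1) * a (?j + 2) * u = a (?j + 2) * a (?j + 3) + M (?j + 1) + a ?j * a (?j + 1) * V"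
    by (simp only: ex comm1)
  have "a k * a (k + 2 * n + 5) = a k * a (k + 2 * n + 3) * u - a k * a (k + 2 * n + 1) * V"
    by (simp only: r1 right_diff_distrib mult.assoc)
  also have "\<dots> = a (?j + 2) * a (?j + 3) + M (?j + 1)
      + M k * (T (n + 2) * u - T (n + 1) * V) + M (k + 1) * (T (n + 1) * u - T n * V)"
    by (simp only: IH0 IH1 distrib_right P) (simp add: algebra_simps)
  also have "\<dots> = a (?j + 2) * a (?j + 3) + M k * T (n + 3) + M (k + 1) * T (n + 2)"
    unfolding t3 t2[symmetric] using M_eps[of k n]
    by (simp add: t2 algebra_simps)
  finally show ?case
    by (simp add: eval_nat_numeral)
qed simp

text \<open>The product \<open>a k * a (k + 3) * p (k + 1)\<close> is evaluated in two ways: by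
  \<open>linear\<close> on its last two factors, and by \<open>exchange\<close> on its first two
  followed by \<open>linear\<close> one step lower.\<close>

lemma product_4: "a k * a (k + 4) = a (k + 2) * a (k + 2) + M k * p (k + 1)"
proof -
  have pc: "p (k + 3) = p (k + 1)" "c (k + 3) = c (k + 1)"
    using p_periodic[of "k + 1"] c_periodic[of "k + 1"] by (simp_all add: eval_nat_numeral)
  have l1: "a (k + 1) * p (k + 1) = a (k + 2) + a k * c (k + 1)"
    by (rule linear)
  have l3: "a (k + 3) * p (k + 1) = a (k + 4) + a (k + 2) * c (k + 1)"
    using linear[of "k + 2"] pc by (simp add: eval_nat_numeral)
  have cm: "a (k + 1) * a (k + 2) = a (k + 2) * a (k + 1)"
    using comm1[of "k + 1"] by (simp add: eval_nat_numeral)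
  have "a k * a (k + 4) + a k * a (k + 2) * c (k + 1) = a k * a (k + 3) * p (k + 1)"
    by (simp only: mult.assoc l3 distrib_left)
  also have "\<dots> = a (k + 2) * a (k + 2) + a k * a (k + 2) * c (k + 1) + M k * p (k + 1)"
    by (simp only: exchange cm distrib_right mult.assoc l1 distrib_left)
      (simp only: mult.assoc[symmetric] comm2 add_ac)
  finally show ?thesis
    by (simp add: algebra_simps)
qed

theorem even_product:
  "a k * a (k + 2 * n + 2) =
     a (k + 2 * ((n + 1) div 2)) * a (k + 2 * ((n + 2) div 2)) + M k * p (k + 1) * T (n + 1)"
proof (induction n rule: T.induct)
  case 2
  have "(3::nat) div 2 = 1" by simp
  then show ?case using product_4[of k] by (simp add: eval_nat_numeral)
next
  case (3 n)
  define P where "P n = a (k + 2 * ((n + 1) div 2)) * a (k + 2 * ((n + 2) div 2))" for n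
  have r1: "a (k + 2 * n + 6) = a (k + 2 * n + 4) * u - a (k + 2 * n + 2) * V"
    using a_recurrence[of "k + 2 * n + 2"] by (simp add: eval_nat_numeral)
  have IH0: "a k * a (k + 2 * n + 2) = P n + M k * p (k + 1) * T (n + 1)"
    using 3(2) by (simp add: P_def)
  have IH1: "a k * a (k + 2 * n + 4) = P (n + 1) + M k * p (k + 1) * T (n + 2)"
    using 3(1) by (simp add: P_def eval_nat_numeral)
  have t3: "T (n + 3) = T (n + 2) * u - T (n + 1) * V + eps (n + 1)"
    by (simp_all add: eval_nat_numeral)
  have Pn1: "P (n + 1) = a (k + 2 * ((n + 2) div 2)) * a (k + 2 * ((n + 3) div 2))"
    and Pn2: "P (n + 2) = a (k + 2 * ((n + 3) div 2)) * a (k + 2 * ((n + 4) div 2))"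
    by (simp_all add: P_def eval_nat_numeral)
  \<comment> \<open>The product on the right advances only one factor at a time. For even
    \<open>n\<close> it satisfies the homogeneous recurrence exactly, in accordance with
    \<open>eps\<close> vanishing at odd arguments; for odd \<open>n\<close> the defect comes from
    \<open>product_4\<close>.\<close>
  have P: "P (n + 1) * u = P (n + 2) + P n * V + M k * p (k + 1) * eps (n + 1)"
  proof (cases "even n")
    case True
    then obtain i where i: "n = 2 * i" by auto
    let ?j = "k + 2 * i"
    have d: "(n + 1) div 2 = i" "(n + 2) div 2 = i + 1" "(n + 3) div 2 = i + 1" "(n + 4) div 2 = i + 2"
      using i by auto
    have Pn: "P n = a ?j * a (?j + 2)" "P (n + 1) = a (?j + 2) * a (?j + 2)"
      "P (n + 2) = a (?j + 2) * a (?j + 4)"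
      unfolding Pn1 Pn2 P_def[of n] d by (simp_all add: eval_nat_numeral)
    have rec: "a (?j + 2) * u = a (?j + 4) + a ?j * V"
      using a_recurrence[of ?j] by simp
    have "eps (n + 1) = 0"
      using eps_odd[of "n + 1"] True by simp
    then show ?thesis
      by (simp only: Pn mult.assoc rec distrib_left mult_zero_right add_0_right)
        (simp only: mult.assoc[symmetric] comm2)
  next
    case False
    then obtain i where i: "n = 2 * i + 1" by (elim oddE)
    let ?j = "k + 2 * i + 2"
    have d: "(n + 1) div 2 = i + 1" "(n + 2) div 2 = i + 1" "(n + 3) div 2 = i + 2" "(n + 4) div 2 = i + 2"
      using i by auto
    have Pn: "P n = a ?j * a ?j" "P (n + 1) = a ?j * a (?j + 2)" "P (n + 2) = a (?j + 2) * a (?j + 2)"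
      unfolding Pn1 Pn2 P_def[of n] d by (simp_all add: eval_nat_numeral)
    have rec: "a (?j + 2) * u = a (?j + 4) + a ?j * V"
      using a_recurrence[of ?j] by simp
    have "p (k + 2 * l + 1) = p (k + 1)" for l
      by (induction l) (use p_periodic[of "k + 2 * l + 1" for l] in simp_all)
    from this[of "i + 1"] have "p (?j + 1) = p (k + 1)"
      by (simp add: algebra_simps)
    \<comment> \<open>Here \<open>?j = k + n + 1\<close> and \<open>eps n = 0\<close>, so one term
      of \<open>M_eps\<close> remains.\<close>
    moreover have "M ?j = M k * eps (n + 1)"
      using M_eps[of k n] False eps_odd[of n] by (simp add: i)
    ultimately have "M ?j * p (?j + 1) = M k * p (k + 1) * eps (n + 1)"
      by (simp add: mult.assoc p_eps del: eps.simps)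
    then have "a ?j * a (?j + 4) = a (?j + 2) * a (?j + 2) + M k * p (k + 1) * eps (n + 1)"
      using product_4[of ?j] by simp
    moreover have "a ?j * a (?j + 2) * u = a ?j * a (?j + 4) + a ?j * a ?j * V"
      by (simp only: mult.assoc rec distrib_left)
    ultimately show ?thesis
      unfolding Pn by (simp only: add_ac)
  qed
  have "a k * a (k + 2 * n + 6) = a k * a (k + 2 * n + 4) * u - a k * a (k + 2 * n + 2) * V"
    by (simp only: r1 right_diff_distrib mult.assoc)
  also have "\<dots> = P (n + 2) + M k * p (k + 1) * T (n + 3)"
    by (simp only: IH0 IH1 distrib_right P t3) (simp add: algebra_simps)
  finally show ?case
    by (simp add: P_def eval_nat_numeral)
qed simp

section \<open>Chebyshev-type sequences and the double sums\<close>

lemma V_U: "V * U n = U n * V" and u_U: "u * U n = U n * u"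
proof -
  have "V * U n = U n * V \<and> u * U n = U n * u"
  proof (induction n rule: less_induct)
    case (less n)
    consider "n = 0" | "n = 1" | "n = 2" | i where "n = i + 3"
      by (metis add.commute add_2_eq_Suc' numeral_3_eq_3 One_nat_def Suc_1 add_Suc_right
          add_0_right not0_implies_Suc)
    then show ?case
    proof cases
      case 3
      have "V * (u * u) = u * u * V" by (metis V_u mult.assoc)
      then show ?thesis
        by (simp add: 3 U_2 power2_eq_square algebra_simps V_u mult_2 mult_2_right)
    next
      case (4 i)
      have IH: "V * U (i + 1) = U (i + 1) * V" "V * U (i + 2) = U (i + 2) * V"
        "u * U (i + 1) = U (i + 1) * u" "u * U (i + 2) = U (i + 2) * u"
        using less 4 by auto
      have "V * (u * U (i + 2)) = u * U (i + 2) * V" "V * (V * U (i + 1)) = V * U (i + 1) * V"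
        "u * (V * U (i + 1)) = V * U (i + 1) * u" "u * (u * U (i + 2)) = u * U (i + 2) * u"
        by (metis V_u IH mult.assoc)+
      then show ?thesis
        by (simp add: 4 U_step left_diff_distrib right_diff_distrib)
    qed (simp_all add: U_0 U_1[simplified] V_u)
  qed
  then show "V * U n = U n * V" "u * U n = U n * u" by blast+
qed

lemma U_step_right: "U (k + 3) = U (k + 2) * u - U (k + 1) * V"
  using U_step V_U u_U by simp

lemma sum_shift:
  fixes g :: "nat \<Rightarrow> 'f"
  shows "(\<Sum>l\<le>(n + 2) div 2. g l) = g 0 + (\<Sum>l\<le>n div 2. g (Suc l))"
  by (simp add: sum.atMost_Suc_shift del: sum.atMost_Suc)

text \<open>With \<open>V\<close> as the determinant parameter, \<open>U\<close> is a Chebyshev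
  sequence of the first kind, except that \<open>U 0\<close> is 1 instead of 2; this lets the last
  term of the sum for even \<open>n\<close> count once. The sums \<open>G\<close> then form the
  Chebyshev sequence of the second kind, starting with 1 and \<open>u\<close>.\<close>

definition G :: "nat \<Rightarrow> 'f" where
  "G n = (\<Sum>l\<le>n div 2. U (n - 2 * l) * V ^ l)"

lemma G_add_2: "G (n + 2) = U (n + 2) + G n * V"
  unfolding G_def sum_shift by (simp add: sum_distrib_right power_Suc2 mult.assoc del: power_Suc)

lemma G_rec: "G (n + 2) = G (n + 1) * u - G n * V"
proof (induction n rule: T.induct)
  case 1
  then show ?case
    by (simp add: G_def eval_nat_numeral U_0 U_1[simplified] U_2[unfolded eval_nat_numeral, simplified])
      (simp add: algebra_simps mult_2)
next
  case 2
  show ?case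
    using U_step_right[of 0] G_add_2[of 1] G_add_2[of 0]
    by (simp add: G_def U_1[simplified] U_0 algebra_simps V_u eval_nat_numeral)
next
  case (3 n)
  have g: "G (n + 4) = U (n + 4) + G (n + 2) * V" "G (n + 3) = U (n + 3) + G (n + 1) * V"
    using G_add_2[of "n + 2"] G_add_2[of "n + 1"] by (simp_all add: eval_nat_numeral)
  have U4: "U (n + 4) = U (n + 3) * u - U (n + 2) * V"
    using U_step_right[of "n + 1"] by (simp add: eval_nat_numeral)
  have e: "G (n + 1) * V * u = (G (n + 2) + G n * V) * V"
    using 3(2) by (simp add: mult.assoc V_u)
  have U2: "U (n + 2) = G (n + 2) - G n * V"
    by (simp only: G_add_2) simp
  have "G (n + 4) = G (n + 3) * u - G (n + 2) * V"
    unfolding g U4 by (simp only: U2 distrib_right e) (simp add: algebra_simps)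
  then show ?case by (simp add: eval_nat_numeral)
qed

text \<open>The forcing term satisfies \<open>eps (n + 2) = \<rho> * eps n * V\<close>, so it drops
  out of the difference \<open>T (n + 4) - \<rho> * T (n + 2) * V\<close>. That difference solves
  the homogeneous recurrence and has the initial values of \<open>G\<close>.\<close>

lemma T_add_4: "T (n + 4) = G (n + 2) + \<rho> * T (n + 2) * V"
proof (induction n rule: T.induct)
  case 1
  then show ?case using G_rec[of 0]
    by (simp add: eval_nat_numeral G_def U_0 U_1[simplified])
next
  case 2
  show ?case
    using G_rec[of 1] G_rec[of 0]
    by (simp add: eval_nat_numeral G_def U_0 U_1[simplified])
      (simp add: algebra_simps \<rho>_central[symmetric] V_u)
next
  case (3 n)
  have t: "T (n + 6) = T (n + 5) * u - T (n + 4) * V + \<rho> * eps (n + 2) * V"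
    "T (n + 4) = T (n + 3) * u - T (n + 2) * V + eps (n + 2)"
    by (simp_all add: eval_nat_numeral)
  have IH: "T (n + 4) = G (n + 2) + \<rho> * T (n + 2) * V" "T (n + 5) = G (n + 3) + \<rho> * T (n + 3) * V"
    using 3 by (simp_all add: eval_nat_numeral)
  have g: "G (n + 4) = G (n + 3) * u - G (n + 2) * V"
    using G_rec[of "n + 2"] by (simp add: eval_nat_numeral)
  have Vu: "x * u * V = x * V * u" for x by (simp add: mult.assoc V_u)
  have "T (n + 6) = (G (n + 3) * u - G (n + 2) * V)
     + \<rho> * (T (n + 3) * u - T (n + 2) * V + eps (n + 2)) * V"
    unfolding t(1) IH
    by (simp only: distrib_right distrib_left left_diff_distrib right_diff_distrib mult.assoc V_u)
      (simp add: algebra_simps)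
  then have "T (n + 6) = G (n + 4) + \<rho> * T (n + 4) * V"
    by (simp only: g t(2))
  then show ?case by (simp add: eval_nat_numeral)
qed

text \<open>Splitting the geometric sum as 1 plus \<open>\<rho>\<close> times a shorter one matches
  \<open>T_add_4\<close>: the 1 contributes to \<open>G\<close>, and the rest is the sum for
  \<open>n\<close> multiplied by \<open>\<rho>\<close> and \<open>V\<close>.\<close>

lemma T_sum: "T (n + 2) = (\<Sum>l\<le>n div 2. (\<Sum>i\<le>l. \<rho> ^ i) * U (n - 2 * l) * V ^ l)"
proof (induction n rule: eps.induct)
  case (3 n)
  have "(\<Sum>l\<le>(n + 2) div 2. (\<Sum>i\<le>l. \<rho> ^ i) * U (n + 2 - 2 * l) * V ^ l)
     = U (n + 2) + (\<Sum>l\<le>n div 2. (1 + \<rho> * (\<Sum>i\<le>l. \<rho> ^ i)) * U (n - 2 * l) * V ^ Suc l)"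
    unfolding sum_shift by (simp add: sum.atMost_Suc_shift sum_distrib_left del: sum.atMost_Suc)
  also have "\<dots> = U (n + 2) + (G n * V + \<rho> * T (n + 2) * V)"
    unfolding 3 G_def
    by (simp add: distrib_right sum.distrib sum_distrib_left sum_distrib_right power_Suc2 mult.assoc del: power_Suc)
  also have "\<dots> = T (n + 4)"
    by (simp only: T_add_4 G_add_2 add_ac)
  finally show ?case by (simp add: eval_nat_numeral)
qed (simp_all add: U_0 U_1[simplified] eval_nat_numeral)

end

section \<open>Coordinates of length six and monomials of the torus\<close>

lemma exhaust_6: "(i::6) = 1 \<or> i = 2 \<or> i = 3 \<or> i = 4 \<or> i = 5 \<or> i = 6"
proof (induct i)
  case (of_int z)
  then have "0 \<le> z" and "z < 6" by simp_all
  then have "z = 0 \<or> z = 1 \<or> z = 2 \<or> z = 3 \<or> z = 4 \<or> z = 5" by arith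
  then show ?case by auto
qed

lemma forall_6: "(\<forall>i::6. P i) \<longleftrightarrow> P 1 \<and> P 2 \<and> P 3 \<and> P 4 \<and> P 5 \<and> P 6"
  by (metis exhaust_6)

lemma UNIV_6: "(UNIV::6 set) = {1, 2, 3, 4, 5, 6}"
  using exhaust_6 by auto

lemma sum_6: "sum f (UNIV::6 set) = f 1 + f 2 + f 3 + f 4 + f 5 + f 6"
  unfolding UNIV_6 by (simp add: ac_simps)

lemma vector_6 [simp]:
  "(vector [a, b, c, d, e, f] :: ('a::zero) ^ 6) $ 1 = a"
  "(vector [a, b, c, d, e, f] :: 'a ^ 6) $ 2 = b"
  "(vector [a, b, c, d, e, f] :: 'a ^ 6) $ 3 = c"
  "(vector [a, b, c, d, e, f] :: 'a ^ 6) $ 4 = d"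
  "(vector [a, b, c, d, e, f] :: 'a ^ 6) $ 5 = e"
  "(vector [a, b, c, d, e, f] :: 'a ^ 6) $ 6 = f"
  unfolding vector_def by simp_all

text \<open>The numerals 0 and 4 arise from evaluating the cyclic reorderings \<open>j - 1\<close>
  and \<open>j + 1\<close> at 1 and 3.\<close>

lemma row3_simps [simp]: "row3 1 = 1" "row3 2 = 2" "row3 3 = 3" "row3 0 = 3" "row3 4 = 1"
  by (simp_all add: row3_def)

lemma index_3 [simp]: "(v :: 'a ^ 3) $ 0 = v $ 3" "v $ 4 = v $ 1"
proof -
  have "(0::3) = 3" "(4::3) = 1" by simp_all
  then show "v $ 0 = v $ 3" "v $ 4 = v $ 1" by (metis (no_types))+
qed

lemma Lam_vector:
  "Lam (vector [a1, a2, a3, a4, a5, a6]) (vector [b1, b2, b3, b4, b5, b6]) =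
     - a1 * b4 - a2 * b5 - a3 * b6 + a4 * (b1 - b5 - b6) + a5 * (b2 + b4 - b6) + a6 * (b3 + b4 + b5)"
  by (simp add: Lam_def Lambda0_def sum_6 algebra_simps)

lemma vector_6_add:
  "vector [a1, a2, a3, a4, a5, a6] + vector [b1, b2, b3, b4, b5, b6] =
     (vector [a1 + b1, a2 + b2, a3 + b3, a4 + b4, a5 + b5, a6 + b6] :: int ^ 6)"
  by (simp add: vec_eq_iff forall_6)

lemma axis_6:
  "axis 1 1 = (vector [1, 0, 0, 0, 0, 0] :: int ^ 6)"
  "axis 2 1 = (vector [0, 1, 0, 0, 0, 0] :: int ^ 6)"
  "axis 3 1 = (vector [0, 0, 1, 0, 0, 0] :: int ^ 6)"
  "axis 4 1 = (vector [0, 0, 0, 1, 0, 0] :: int ^ 6)"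
  "axis 5 1 = (vector [0, 0, 0, 0, 1, 0] :: int ^ 6)"
  "axis 6 1 = (vector [0, 0, 0, 0, 0, 1] :: int ^ 6)"
  by (simp_all add: vec_eq_iff forall_6 axis_def)

lemmas qX_vector = qX_mult Lam_vector vector_6_add axis_6

lemma qX_inject: "qX k c = qX l d \<longleftrightarrow> k = l \<and> c = d"
proof
  assume "qX k c = qX l d"
  then have "Poly_Mapping.single c (Poly_Mapping.single k (1::int)) = Poly_Mapping.single d (Poly_Mapping.single l 1)"
    unfolding qX_def by (simp add: Torus_inject)
  then have "Poly_Mapping.lookup (Poly_Mapping.lookup (Poly_Mapping.single d (Poly_Mapping.single l (1::int))) c) k = 1"
    by (metis lookup_single_eq)
  then show "k = l \<and> c = d"
    by (auto simp: lookup_single when_def split: if_splits)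
qed simp

lemma one_qX: "1 = qX 0 0"
  unfolding qX_def by (simp add: one_qtorus.abs_eq)

section \<open>The skew pairing of y-exponents, and mutations of seeds of one fixed shape\<close>

definition dot3 :: "int ^ 3 \<Rightarrow> int ^ 3 \<Rightarrow> int" where
  "dot3 v d = v $ 1 * d $ 1 + v $ 2 * d $ 2 + v $ 3 * d $ 3"

text \<open>The weight (in the sense of \<open>weight\<close> below) of the monomial in the \<open>y\<^sub>i\<close> with exponent \<open>c\<close>.\<close>

definition yweight :: "int ^ 3 \<Rightarrow> int ^ 3" where
  "yweight c = vector [c $ 2 + c $ 3, c $ 3 - c $ 1, - c $ 1 - c $ 2]"

lemma dot3_simps [simp]:
  "dot3 (v + v') d = dot3 v d + dot3 v' d" "dot3 (v - v') d = dot3 v d - dot3 v' d"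
  "dot3 (- v) d = - dot3 v d" "dot3 v (- d) = - dot3 v d" "dot3 v (d + d') = dot3 v d + dot3 v d'"
  "dot3 v 0 = 0" "dot3 0 d = 0" "dot3 (yweight d) d = 0"
  by (simp_all add: dot3_def yweight_def algebra_simps)

text \<open>The pairing \<open>dot3 (yweight c) d\<close> is the form \<open>Lam\<close> restricted
  to the last three coordinates, hence skew-symmetric.\<close>

lemma dot3_yweight: "dot3 (yweight c) d = - dot3 (yweight d) c"
  by (simp add: dot3_def yweight_def algebra_simps)

text \<open>The seeds \<open>\<Sigma>\<^sub>m\<close> differ only in the quasi-commutation weights \<open>w\<^sub>i\<close> of the cluster variables with the
  \<open>y\<^sub>j\<close> and in the columns \<open>p, q, r\<close> of the lower half of the exchange matrix.\<close>

definition torus_seed ::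
  "int ^ 3 \<Rightarrow> int ^ 3 \<Rightarrow> int ^ 3 \<Rightarrow> int ^ 3 \<Rightarrow> int ^ 3 \<Rightarrow> int ^ 3 \<Rightarrow> 'f ^ 6 \<Rightarrow> 'f qseed" where
  "torus_seed w1 w2 w3 p q r x = \<lparr>
     seed_lam = vector [
       vector [0, 0, 0, w1 $ 1, w1 $ 2, w1 $ 3],
       vector [0, 0, 0, w2 $ 1, w2 $ 2, w2 $ 3],
       vector [0, 0, 0, w3 $ 1, w3 $ 2, w3 $ 3],
       vector [- w1 $ 1, - w2 $ 1, - w3 $ 1, 0, -1, -1],
       vector [- w1 $ 2, - w2 $ 2, - w3 $ 2, 1, 0, -1],
       vector [- w1 $ 3, - w2 $ 3, - w3 $ 3, 1, 1, 0]],
     seed_b = vector [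
       vector [0, 1, 1],
       vector [-1, 0, 1],
       vector [-1, -1, 0],
       vector [p $ 1, q $ 1, r $ 1],
       vector [p $ 2, q $ 2, r $ 2],
       vector [p $ 3, q $ 3, r $ 3]],
     seed_X = x \<rparr>"

lemma seed_X_torus_seed [simp]: "seed_X (torus_seed w1 w2 w3 p q r x) = x"
  by (simp add: torus_seed_def)

text \<open>For nonnegative \<open>p\<close> the negative parts of the mutated column sit only in
  the rows of the other two cluster variables; this gives the weight \<open>w2 + w3 - w1\<close> and
  leaves the y-monomial alone in its summand. The cyclic reordering restores the upper block of the
  exchange matrix.\<close>

lemma seed_next_torus_seed:
  assumes "\<forall>i. p $ i \<ge> 0"
  shows "seed_next h (torus_seed w1 w2 w3 p q r x) =
    torus_seed w2 w3 (w2 + w3 - w1) (q + p) (r + p) (- p)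
      (vector [x $ 2, x $ 3,
         frame h (torus_seed w1 w2 w3 p q r x) (vector [-1, 0, 0, p $ 1, p $ 2, p $ 3])
         + frame h (torus_seed w1 w2 w3 p q r x) (vector [-1, 1, 1, 0, 0, 0]), x $ 4, x $ 5, x $ 6])"
    (is "?S = ?T")
proof -
  let ?B = "seed_b (torus_seed w1 w2 w3 p q r x)"
  have p: "p $ 1 \<ge> 0" "p $ 2 \<ge> 0" "p $ 3 \<ge> 0"
    using assms by auto
  have c: "(\<chi> i. max (?B $ i $ 1) 0) - axis 1 1 = vector [-1, 0, 0, p $ 1, p $ 2, p $ 3]"
    "(\<chi> i. max (- (?B $ i $ 1)) 0) - axis 1 1 = vector [-1, 1, 1, 0, 0, 0]"
    using p by (simp_all add: vec_eq_iff forall_6 torus_seed_def axis_def)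
  have "seed_lam ?S = seed_lam ?T"
    using p by (simp add: torus_seed_def seed_next_def reorder_def mutate_def vec_eq_iff forall_6
        matrix_matrix_mult_def transpose_def mut_E_def row_perm_def sum_6)
  moreover have "seed_b ?S = seed_b ?T"
    using p by (simp add: torus_seed_def seed_next_def reorder_def mutate_def vec_eq_iff forall_6
        forall_3 mut_b_def row_perm_def)
  moreover have "seed_X ?S = seed_X ?T"
    by (simp add: seed_next_def reorder_def mutate_def c vec_eq_iff forall_6 row_perm_def)
  ultimately show ?thesis
    by (intro qseed.equality) simp_all
qed

text \<open>The column in direction 3 has no negative part, so the new weight is
  \<open>- w3\<close>, and the y-monomial is attached to the product of the other two
  variables.\<close>

lemma seed_prev_torus_seed_nonneg:
  assumes "\<forall>i. r $ i \<ge> 0"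
  shows "seed_prev h (torus_seed w1 w2 w3 p q r x) =
    torus_seed (- w3) w1 w2 (- r) p q
      (vector [frame h (torus_seed w1 w2 w3 p q r x) (vector [1, 1, -1, r $ 1, r $ 2, r $ 3])
         + frame h (torus_seed w1 w2 w3 p q r x) (vector [0, 0, -1, 0, 0, 0]),
         x $ 1, x $ 2, x $ 4, x $ 5, x $ 6])"
    (is "?S = ?T")
proof -
  let ?B = "seed_b (torus_seed w1 w2 w3 p q r x)"
  have r: "r $ 1 \<ge> 0" "r $ 2 \<ge> 0" "r $ 3 \<ge> 0"
    using assms by auto
  have c: "(\<chi> i. max (?B $ i $ 3) 0) - axis 3 1 = vector [1, 1, -1, r $ 1, r $ 2, r $ 3]"
    "(\<chi> i. max (- (?B $ i $ 3)) 0) - axis 3 1 = vector [0, 0, -1, 0, 0, 0]"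
    using r by (simp_all add: vec_eq_iff forall_6 torus_seed_def axis_def)
  have "seed_lam ?S = seed_lam ?T"
    using r by (simp add: torus_seed_def seed_prev_def reorder_def mutate_def vec_eq_iff forall_6
        matrix_matrix_mult_def transpose_def mut_E_def row_perm_def sum_6)
  moreover have "seed_b ?S = seed_b ?T"
    using r by (simp add: torus_seed_def seed_prev_def reorder_def mutate_def vec_eq_iff forall_6
        forall_3 mut_b_def row_perm_def)
  moreover have "seed_X ?S = seed_X ?T"
    by (simp add: seed_prev_def reorder_def mutate_def c vec_eq_iff forall_6 row_perm_def)
  ultimately show ?thesis
    by (intro qseed.equality) simp_all
qed

text \<open>Now the negative part of the column lies in the rows of the y_i, which contributes
  \<open>- yweight r\<close> to the new weight. The two orthogonality hypotheses make the entries
  between the new variable and its neighbours vanish, as the shape \<open>torus_seed\<close>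
  demands.\<close>

lemma seed_prev_torus_seed_nonpos:
  assumes "\<forall>i. r $ i \<le> 0" and "dot3 w1 r = 0" "dot3 w2 r = 0"
  shows "seed_prev h (torus_seed w1 w2 w3 p q r x) =
    torus_seed (- w3 - yweight r) w1 w2 (- r) (p + r) (q + r)
      (vector [frame h (torus_seed w1 w2 w3 p q r x) (vector [1, 1, -1, 0, 0, 0])
         + frame h (torus_seed w1 w2 w3 p q r x) (vector [0, 0, -1, - r $ 1, - r $ 2, - r $ 3]),
         x $ 1, x $ 2, x $ 4, x $ 5, x $ 6])"
    (is "?S = ?T")
proof -
  let ?B = "seed_b (torus_seed w1 w2 w3 p q r x)"
  have r: "r $ 1 \<le> 0" "r $ 2 \<le> 0" "r $ 3 \<le> 0"
    using assms by auto
  have c: "(\<chi> i. max (?B $ i $ 3) 0) - axis 3 1 = vector [1, 1, -1, 0, 0, 0]"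
    "(\<chi> i. max (- (?B $ i $ 3)) 0) - axis 3 1 = vector [0, 0, -1, - r $ 1, - r $ 2, - r $ 3]"
    using r by (simp_all add: vec_eq_iff forall_6 torus_seed_def axis_def)
  have "seed_lam ?S = seed_lam ?T"
    using r assms(2,3)
    by (simp add: torus_seed_def seed_prev_def reorder_def mutate_def vec_eq_iff forall_6
        matrix_matrix_mult_def transpose_def mut_E_def row_perm_def sum_6 dot3_def yweight_def)
      (simp add: algebra_simps)
  moreover have "seed_b ?S = seed_b ?T"
    using r by (simp add: torus_seed_def seed_prev_def reorder_def mutate_def vec_eq_iff forall_6
        forall_3 mut_b_def row_perm_def)
  moreover have "seed_X ?S = seed_X ?T"
    by (simp add: seed_prev_def reorder_def mutate_def c vec_eq_iff forall_6 row_perm_def)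
  ultimately show ?thesis
    by (intro qseed.equality) simp_all
qed

lemma sum_pairs_6:
  "(\<Sum>i = 1..6. \<Sum>j = i + 1..6. g (of_nat i :: 6) (of_nat j :: 6)) =
    g 1 2 + g 1 3 + g 1 4 + g 1 5 + g 1 6 + g 2 3 + g 2 4 + g 2 5 + g 2 6
    + g 3 4 + g 3 5 + g 3 6 + g 4 5 + g 4 6 + (g 5 6 :: int)"
proof -
  have "{Suc 0..6} = {1,2,3,4,5,6}" "{Suc (Suc 0)..6} = {2,3,4,5,6}" "{2..6::nat} = {2,3,4,5,6}" "{3..6::nat} = {3,4,5,6}"
    "{4..6::nat} = {4,5,6}" "{5..6::nat} = {5,6}" "{6..6::nat} = {6}" "{7..6::nat} = {}"
    by auto
  then show ?thesis
    by simp
qed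

section \<open>Monomials in the y_i, weights and a single mutation inside the skew-field\<close>

locale skew_fraction_field =
  fixes \<iota> :: "qtorus \<Rightarrow> 'f::division_ring"
  assumes frac: "is_skew_fraction_field \<iota>"
begin

lemma \<iota>_one [simp]: "\<iota> 1 = 1"
  and \<iota>_add: "\<iota> (a + b) = \<iota> a + \<iota> b"
  and \<iota>_mult: "\<iota> (a * b) = \<iota> a * \<iota> b"
  and \<iota>_eq_iff [simp]: "\<iota> a = \<iota> b \<longleftrightarrow> a = b"
  using frac by (auto simp: is_skew_fraction_field_def inj_eq)

lemma \<iota>_zero [simp]: "\<iota> 0 = 0"
  using \<iota>_add[of 0 0] by simp

lemma \<iota>_diff: "\<iota> (a - b) = \<iota> a - \<iota> b"
  using \<iota>_add[of "a - b" b] by (simp add: algebra_simps)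

lemma \<iota>_fraction: "\<exists>a b. \<iota> b \<noteq> 0 \<and> x = \<iota> a * inverse (\<iota> b)"
  using frac \<iota>_eq_iff[of _ 0] unfolding is_skew_fraction_field_def \<iota>_zero by metis

lemma yweight_zero [simp]: "yweight 0 = 0"
  by (simp add: yweight_def vec_eq_iff forall_3)

definition ymon :: "int \<Rightarrow> int ^ 3 \<Rightarrow> 'f" where
  "ymon k d = \<iota> (qX k (vector [0, 0, 0, d $ 1, d $ 2, d $ 3]))"

lemma ymon_mult:
  "ymon k c * ymon l d = ymon (k + l + dot3 (yweight c) d) (c + d)"
  by (simp add: ymon_def \<iota>_mult[symmetric] qX_vector dot3_def yweight_def algebra_simps)

lemma ymon_inject: "ymon k c = ymon l d \<longleftrightarrow> k = l \<and> c = d"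
  by (auto simp: ymon_def qX_inject vec_eq_iff forall_6 forall_3)

lemma ymon_zero: "ymon 0 0 = 1"
proof -
  have "vector [0, 0, 0, 0, 0, 0] = (0 :: int ^ 6)" by (simp add: vec_eq_iff forall_6)
  then show ?thesis by (simp add: ymon_def one_qX[symmetric])
qed

lemma qhalf_ymon: "\<iota> qhalf = ymon 1 0"
proof -
  have "vector [0, 0, 0, 0, 0, 0] = (0 :: int ^ 6)" by (simp add: vec_eq_iff forall_6)
  then show ?thesis by (simp add: ymon_def qhalf_def)
qed

lemma yvar_ymon:
  "yvar \<iota> 1 = ymon 0 (vector [1, 0, 0])" "yvar \<iota> 2 = ymon 0 (vector [0, 1, 0])"
  "yvar \<iota> 3 = ymon 0 (vector [0, 0, 1])"
  by (simp_all add: yvar_def ymon_def axis_6)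

lemma ymon_inverse: "inverse (ymon k c) = ymon (- k) (- c)"
  by (rule inverse_unique) (simp add: ymon_mult ymon_zero)

lemma ymon_nonzero [simp]: "ymon k c \<noteq> 0"
  using ymon_mult[of k c "- k" "- c"] ymon_zero by auto

lemma ymon_power: "ymon k c ^ n = ymon (int n * k) (int n *s c)"
proof (induction n)
  case 0
  have "0 *s c = 0" by (simp add: vec_eq_iff)
  then show ?case by (simp add: ymon_zero)
next
  case (Suc n)
  have "c + int n *s c = (1 + int n) *s c" "dot3 (yweight c) (int n *s c) = 0"
    by (simp_all add: vec_eq_iff forall_3 dot3_def yweight_def algebra_simps)
  then show ?case by (simp add: Suc ymon_mult algebra_simps)
qed

lemma ymon_powi: "ymon k c powi n = ymon (n * k) (n *s c)"
proof (cases "n \<ge> 0")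
  case True
  then show ?thesis by (simp add: power_int_def ymon_power)
next
  case False
  have "(- n) *s (- c) = n *s c" by (simp add: vec_eq_iff)
  then show ?thesis using False by (simp add: power_int_def ymon_power ymon_inverse)
qed

text \<open>On basis elements of the torus this is \<open>Lam 0 c = 0\<close>; additivity extends it
  to the torus. Every element of the skew-field is a fraction, and commuting with a denominator
  implies commuting with its inverse.\<close>

lemma ymon_central: "ymon k 0 * x = x * ymon k 0"
proof -
  have c: "ymon k 0 * \<iota> a = \<iota> a * ymon k 0" for a
  proof -
    have z: "vector [0, 0, 0, 0, 0, 0] = (0 :: int ^ 6)" by (simp add: vec_eq_iff forall_6)
    obtain t where a: "a = Torus t" using Torus_cases by blast
    have "qX k 0 * Torus t = Torus t * qX k 0" for t
    proof (induction t rule: torus_coeff_induct)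
      case (single c p)
      then show ?case
        unfolding qX_def
        by (simp add: times_qtorus.abs_eq eq_onp_def torus_mult_single mult.commute)
    next
      case (add s t)
      have "Torus (s + t) = Torus s + Torus t"
        by (simp add: plus_qtorus.abs_eq eq_onp_def)
      then show ?case using add by (simp add: algebra_simps)
    qed
    then show ?thesis by (simp add: ymon_def z a \<iota>_mult[symmetric])
  qed
  obtain a b where x: "\<iota> b \<noteq> 0" "x = \<iota> a * inverse (\<iota> b)" using \<iota>_fraction by blast
  have "inverse (\<iota> b) * (ymon k 0 * \<iota> b) * inverse (\<iota> b) = inverse (\<iota> b) * (\<iota> b * ymon k 0) * inverse (\<iota> b)"
    by (simp only: c)
  moreover have "inverse (\<iota> b) * (ymon k 0 * \<iota> b) * inverse (\<iota> b) = inverse (\<iota> b) * ymon k 0"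
    using x(1) by (simp add: mult.assoc)
  moreover have "inverse (\<iota> b) * (\<iota> b * ymon k 0) * inverse (\<iota> b) = ymon k 0 * inverse (\<iota> b)"
    using x(1) by (simp add: mult.assoc[symmetric])
  ultimately have i: "inverse (\<iota> b) * ymon k 0 = ymon k 0 * inverse (\<iota> b)"
    by simp
  show ?thesis
    unfolding x(2) by (simp only: mult.assoc i) (simp only: mult.assoc[symmetric] c)
qed

text \<open>This is quasi-commutation with all monomials in the y_i at once; the factor 2 is there
  because \<open>ymon\<close> counts half powers of q. Unlike an explicit expansion in the torus,
  the property is preserved by products, by inverses, and by sums of elements of equal
  weight.\<close>

definition weight :: "'f \<Rightarrow> int ^ 3 \<Rightarrow> bool" where
  "weight x w \<longleftrightarrow> (\<forall>k d. x * ymon k d = ymon (k + 2 * dot3 w d) d * x)"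

lemma weightD: "weight x w \<Longrightarrow> x * ymon k d = ymon (k + 2 * dot3 w d) d * x"
  by (simp add: weight_def)

lemma weight_mult:
  assumes "weight x v" "weight y w"
  shows "weight (x * y) (v + w)"
  unfolding weight_def
proof (intro allI)
  fix k d
  have "x * y * ymon k d = x * ymon (k + 2 * dot3 w d) d * y"
    by (simp only: mult.assoc weightD[OF assms(2), of k d])
  also have "\<dots> = ymon (k + 2 * dot3 w d + 2 * dot3 v d) d * (x * y)"
    by (simp only: weightD[OF assms(1)] mult.assoc)
  finally show "x * y * ymon k d = ymon (k + 2 * dot3 (v + w) d) d * (x * y)"
    by (simp add: algebra_simps)
qed

lemma weight_add:
  assumes "weight x w" "weight y w"
  shows "weight (x + y) w"
  unfolding weight_def
  by (simp only: distrib_left distrib_right weightD[OF assms(1)] weightD[OF assms(2)]) simp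

lemma weight_ymon: "weight (ymon k c) (yweight c)"
  unfolding weight_def
proof (intro allI)
  fix l d
  have "k + l + dot3 (yweight c) d = l + 2 * dot3 (yweight c) d + k + dot3 (yweight d) c"
    using dot3_yweight[of c d] by simp
  then show "ymon k c * ymon l d = ymon (l + 2 * dot3 (yweight c) d) d * ymon k c"
    by (simp only: ymon_mult add.commute[of c d])
qed

lemma weight_one: "weight 1 0"
  by (simp add: weight_def)

lemma weight_inverse:
  assumes "weight x w" "x \<noteq> 0"
  shows "weight (inverse x) (- w)"
  unfolding weight_def
proof (intro allI)
  fix k d
  have "x * ymon (k - 2 * dot3 w d) d = ymon k d * x"
    using weightD[OF assms(1), of "k - 2 * dot3 w d" d] by simp
  then have "inverse x * (x * ymon (k - 2 * dot3 w d) d) * inverse x = inverse x * (ymon k d * x) * inverse x"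
    by (simp only:)
  moreover have "inverse x * (ymon k d * x) * inverse x = inverse x * ymon k d"
    using assms(2) by (simp add: mult.assoc)
  moreover have "inverse x * (x * ymon (k - 2 * dot3 w d) d) * inverse x = ymon (k - 2 * dot3 w d) d * inverse x"
    using assms(2) by (simp add: mult.assoc[symmetric])
  ultimately show "inverse x * ymon k d = ymon (k + 2 * dot3 (- w) d) d * inverse x"
    by simp
qed

lemma weight_commute: "weight x w \<Longrightarrow> dot3 w d = 0 \<Longrightarrow> x * ymon k d = ymon k d * x"
  by (simp add: weight_def)

definition with_y :: "'f \<Rightarrow> 'f \<Rightarrow> 'f \<Rightarrow> 'f ^ 6" where
  "with_y x1 x2 x3 = vector [x1, x2, x3, yvar \<iota> 1, yvar \<iota> 2, yvar \<iota> 3]"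

text \<open>The power of q coming from pairs of y_i is exactly what turns their ordered product into
  the normalised monomial. Pairs of cluster variables contribute nothing, so only the pairings of
  the weights with the y-exponent remain.\<close>

lemma frame_torus_seed:
  "frame (\<iota> qhalf) (torus_seed w1 w2 w3 p q r (with_y x1 x2 x3)) (vector [c1, c2, c3, d1, d2, d3]) =
    ymon (- c1 * dot3 w1 (vector [d1, d2, d3]) - c2 * dot3 w2 (vector [d1, d2, d3]) - c3 * dot3 w3 (vector [d1, d2, d3])) 0
    * (x1 powi c1) * (x2 powi c2) * (x3 powi c3) * ymon 0 (vector [d1, d2, d3])"
proof -
  let ?e = "- c1 * dot3 w1 (vector [d1, d2, d3]) - c2 * dot3 w2 (vector [d1, d2, d3]) - c3 * dot3 w3 (vector [d1, d2, d3])"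
  have s: "d1 *s vector [1, 0, 0] + d2 *s vector [0, 1, 0] + d3 *s vector [0, 0, 1] = (vector [d1, d2, d3] :: int ^ 3)"
    "n *s (0 :: int ^ 3) = 0" for n
    by (simp_all add: vec_eq_iff forall_3)
  have y: "(yvar \<iota> 1 powi d1) * (yvar \<iota> 2 powi d2) * (yvar \<iota> 3 powi d3) =
    ymon (- d1 * d2 - d1 * d3 - d2 * d3) (vector [d1, d2, d3])"
    by (simp add: yvar_ymon ymon_powi ymon_mult s) (simp add: dot3_def yweight_def algebra_simps)
  let ?S = "torus_seed w1 w2 w3 p q r (with_y x1 x2 x3)"
  let ?c = "vector [c1, c2, c3, d1, d2, d3] :: int ^ 6"
  have e: "- (\<Sum>i = 1..6. \<Sum>j = i + 1..6. ?c $ of_nat i * ?c $ of_nat j * seed_lam ?S $ of_nat i $ of_nat j)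
    = ?e + (d1 * d2 + d1 * d3 + d2 * d3)"
    unfolding sum_pairs_6[where g = "\<lambda>i j. ?c $ i * ?c $ j * seed_lam ?S $ i $ j"]
    by (simp add: torus_seed_def dot3_def) (simp add: algebra_simps)
  have "frame (\<iota> qhalf) ?S ?c
    = ymon (?e + (d1 * d2 + d1 * d3 + d2 * d3)) 0 * ((x1 powi c1) * (x2 powi c2) * (x3 powi c3))
      * ((yvar \<iota> 1 powi d1) * (yvar \<iota> 2 powi d2) * (yvar \<iota> 3 powi d3))"
    unfolding frame_def e qhalf_ymon ymon_powi[of _ 0]
    by (simp add: with_y_def s mult.assoc)
  also have "ymon (?e + (d1 * d2 + d1 * d3 + d2 * d3)) 0 = ymon ?e 0 * ymon (d1 * d2 + d1 * d3 + d2 * d3) 0"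
    by (simp add: ymon_mult)
  also have "ymon ?e 0 * ymon (d1 * d2 + d1 * d3 + d2 * d3) 0 * ((x1 powi c1) * (x2 powi c2) * (x3 powi c3))
      * ((yvar \<iota> 1 powi d1) * (yvar \<iota> 2 powi d2) * (yvar \<iota> 3 powi d3))
     = ymon ?e 0 * ((x1 powi c1) * (x2 powi c2) * (x3 powi c3)) * ymon 0 (vector [d1, d2, d3])"
    unfolding y mult.assoc[of "ymon ?e 0"] ymon_central[of "d1 * d2 + d1 * d3 + d2 * d3" "(x1 powi c1) * (x2 powi c2) * (x3 powi c3)"]
    by (simp only: mult.assoc) (simp add: ymon_mult)
  finally show ?thesis by (simp only: mult.assoc)
qed

lemma commute_inverse:
  fixes x c :: 'f
  assumes "c * x = x * c" "x \<noteq> 0"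
  shows "c * inverse x = inverse x * c"
proof -
  have "inverse x * (c * x) * inverse x = inverse x * (x * c) * inverse x"
    by (simp only: assms(1))
  moreover have "inverse x * (c * x) * inverse x = inverse x * c"
    using assms(2) by (simp add: mult.assoc)
  moreover have "inverse x * (x * c) * inverse x = c * inverse x"
    using assms(2) by (simp add: mult.assoc[symmetric])
  ultimately show ?thesis by simp
qed

text \<open>Moving \<open>x\<close> past the monomial changes its exponent of \<open>q^(1/2)\<close>
  by \<open>2 * dot3 w d\<close>; this is why the products in the two orders carry opposite
  exponents. The elements \<open>a\<close> and \<open>b\<close> are 1 and the product of the two
  other cluster variables, in either role.\<close>

lemma exchange_relations:
  assumes x: "weight x w" "x \<noteq> 0" and a: "a * x = x * a" "a \<noteq> 0" and b: "b * x = x * b"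
    and d: "dot3 w d \<noteq> 0"
    and y: "y = inverse x * (b + a * ymon (dot3 w d) d)"
  shows "x * y = b + a * ymon (dot3 w d) d" "y * x = b + a * ymon (- dot3 w d) d" "y \<noteq> 0"
proof -
  show xy: "x * y = b + a * ymon (dot3 w d) d"
    using x(2) by (simp add: y mult.assoc[symmetric])
  have "ymon (dot3 w d) d * x = x * ymon (- dot3 w d) d"
    using weightD[OF x(1), of "- dot3 w d" d] by simp
  then have "(b + a * ymon (dot3 w d) d) * x = x * (b + a * ymon (- dot3 w d) d)"
    by (simp only: distrib_left distrib_right mult.assoc b) (simp only: mult.assoc[symmetric] a)
  then show yx: "y * x = b + a * ymon (- dot3 w d) d"
    using x(2) by (simp only: y mult.assoc) (simp add: mult.assoc[symmetric])
  txt \<open>If \<open>y\<close> vanished, then the right-hand sides of both relations would be equal.\<close>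
  show "y \<noteq> 0"
  proof
    assume "y = 0"
    then have "ymon (dot3 w d) d = ymon (- dot3 w d) d"
      using xy yx a(2) by (metis add_left_cancel mult_left_cancel mult_zero_left mult_zero_right)
    then show False
      using d by (simp add: ymon_inject)
  qed
qed

lemma exchange_commute:
  assumes "c * x = x * c" "x \<noteq> 0" "c * a = a * c" "c * b = b * c" "weight c v" "dot3 v d = 0"
  shows "c * (inverse x * (b + a * ymon k d)) = inverse x * (b + a * ymon k d) * c"
proof -
  have "c * (b + a * ymon k d) = (b + a * ymon k d) * c"
    by (simp only: distrib_left distrib_right assms(4) mult.assoc weight_commute[OF assms(5,6), symmetric])
      (simp only: mult.assoc[symmetric] assms(3))
  then show ?thesis
    by (simp only: mult.assoc[symmetric] commute_inverse[OF assms(1,2)]) (simp only: mult.assoc)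
qed

text \<open>The hypothesis on \<open>b\<close> says that both summands of the exchange binomial have
  the same weight.\<close>

lemma exchange_weight:
  assumes "weight x w" "x \<noteq> 0" "weight a \<alpha>" "weight b (\<alpha> + yweight d)"
  shows "weight (inverse x * (b + a * ymon k d)) (\<alpha> + yweight d - w)"
  using weight_mult[OF weight_inverse[OF assms(1,2)]
      weight_add[OF assms(4) weight_mult[OF assms(3) weight_ymon[of k d]]]]
  by simp

text \<open>The invariant of the mutation process. It requires the weights in the matrix to be
  realised by the actual elements, and it includes nonvanishing because a mutation inverts a cluster
  variable.\<close>

definition cluster_seed where
  "cluster_seed w1 w2 w3 p q r S \<longleftrightarrow>
     S = torus_seed w1 w2 w3 p q r (with_y (seed_X S $ 1) (seed_X S $ 2) (seed_X S $ 3)) \<and>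
     weight (seed_X S $ 1) w1 \<and> weight (seed_X S $ 2) w2 \<and> weight (seed_X S $ 3) w3 \<and>
     seed_X S $ 1 \<noteq> 0 \<and> seed_X S $ 2 \<noteq> 0 \<and> seed_X S $ 3 \<noteq> 0 \<and>
     seed_X S $ 2 * seed_X S $ 1 = seed_X S $ 1 * seed_X S $ 2 \<and>
     seed_X S $ 3 * seed_X S $ 1 = seed_X S $ 1 * seed_X S $ 3 \<and>
     seed_X S $ 3 * seed_X S $ 2 = seed_X S $ 2 * seed_X S $ 3"

lemma vector_3_eta: "vector [d $ 1, d $ 2, d $ 3] = (d :: 'a::zero ^ 3)"
  by (simp add: vec_eq_iff forall_3)

lemma vector_3_zero: "vector [0, 0, 0] = (0 :: 'a::zero ^ 3)"
  by (simp add: vec_eq_iff forall_3)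

text \<open>Apart from the sign condition, the hypotheses on \<open>p\<close> express compatibility
  of the two matrices in column 1: a nonzero diagonal entry, zero entries at the two neighbours,
  and, at the rows of the y_i, the equation \<open>yweight p = w2 + w3\<close>, which makes the
  exchange binomial homogeneous.\<close>

lemma cluster_seed_next:
  assumes S: "cluster_seed w1 w2 w3 p q r S"
    and p: "\<forall>i. p $ i \<ge> 0" "dot3 w1 p \<noteq> 0" "dot3 w2 p = 0" "dot3 w3 p = 0" "yweight p = w2 + w3"
  defines "T \<equiv> seed_next (\<iota> qhalf) S"
  shows "cluster_seed w2 w3 (w2 + w3 - w1) (q + p) (r + p) (- p) T"
    and "seed_X T $ 1 = seed_X S $ 2" "seed_X T $ 2 = seed_X S $ 3"
    and "seed_X S $ 1 * seed_X T $ 3 = seed_X S $ 2 * seed_X S $ 3 + ymon (dot3 w1 p) p"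
    and "seed_X T $ 3 * seed_X S $ 1 = seed_X S $ 2 * seed_X S $ 3 + ymon (- dot3 w1 p) p"
proof -
  define x1 x2 x3 where x: "x1 = seed_X S $ 1" "x2 = seed_X S $ 2" "x3 = seed_X S $ 3"
  have S': "S = torus_seed w1 w2 w3 p q r (with_y x1 x2 x3)"
    and w: "weight x1 w1" "weight x2 w2" "weight x3 w3"
    and nz: "x1 \<noteq> 0" "x2 \<noteq> 0" "x3 \<noteq> 0"
    and c: "x2 * x1 = x1 * x2" "x3 * x1 = x1 * x3" "x3 * x2 = x2 * x3"
    using S unfolding cluster_seed_def x by blast+
  define y where "y = inverse x1 * (x2 * x3 + 1 * ymon (dot3 w1 p) p)"
  have "ymon (dot3 w1 p) 0 * inverse x1 * ymon 0 p = inverse x1 * ymon (dot3 w1 p) p"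
    by (simp only: ymon_central mult.assoc) (simp add: ymon_mult)
  then have T: "T = torus_seed w2 w3 (w2 + w3 - w1) (q + p) (r + p) (- p) (with_y x2 x3 y)"
    unfolding T_def S' seed_next_torus_seed[OF p(1)] frame_torus_seed
    by (simp add: y_def with_y_def vector_3_eta vector_3_zero ymon_zero power_int_minus distrib_left mult.assoc add.commute)
  have X: "seed_X T $ 1 = x2" "seed_X T $ 2 = x3" "seed_X T $ 3 = y"
    by (simp_all add: T with_y_def)
  have c23: "x2 * x3 * x1 = x1 * (x2 * x3)" "x2 * (x2 * x3) = x2 * x3 * x2" "x3 * (x2 * x3) = x2 * x3 * x3"
    by (metis c mult.assoc)+
  note rel = exchange_relations[OF w(1) nz(1) _ _ c23(1) p(2) y_def]
  have "x2 * y = y * x2" "x3 * y = y * x3"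
    unfolding y_def using exchange_commute[OF c(1) nz(1) _ c23(2) w(2) p(3), of 1]
      exchange_commute[OF c(2) nz(1) _ c23(3) w(3) p(4), of 1] by simp_all
  moreover have "weight y (w2 + w3 - w1)"
    using exchange_weight[OF w(1) nz(1) weight_one, of "x2 * x3" p] weight_mult[OF w(2,3)]
    unfolding y_def by (simp add: p(5))
  ultimately show "cluster_seed w2 w3 (w2 + w3 - w1) (q + p) (r + p) (- p) T"
    unfolding cluster_seed_def X using w nz c rel by (simp add: T)
  show "seed_X T $ 1 = seed_X S $ 2" "seed_X T $ 2 = seed_X S $ 3"
    "seed_X S $ 1 * seed_X T $ 3 = seed_X S $ 2 * seed_X S $ 3 + ymon (dot3 w1 p) p"
    "seed_X T $ 3 * seed_X S $ 1 = seed_X S $ 2 * seed_X S $ 3 + ymon (- dot3 w1 p) p"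
    unfolding X x[symmetric] using rel by simp_all
qed

lemma cluster_seed_prev_nonneg:
  assumes S: "cluster_seed w1 w2 w3 p q r S"
    and r: "\<forall>i. r $ i \<ge> 0" "dot3 w3 r \<noteq> 0" "dot3 w1 r = 0" "dot3 w2 r = 0" "w1 + w2 + yweight r = 0"
  defines "T \<equiv> seed_prev (\<iota> qhalf) S"
  shows "cluster_seed (- w3) w1 w2 (- r) p q T"
    and "seed_X T $ 2 = seed_X S $ 1" "seed_X T $ 3 = seed_X S $ 2"
    and "seed_X S $ 3 * seed_X T $ 1 = 1 + seed_X S $ 1 * seed_X S $ 2 * ymon (dot3 w3 r) r"
    and "seed_X T $ 1 * seed_X S $ 3 = 1 + seed_X S $ 1 * seed_X S $ 2 * ymon (- dot3 w3 r) r"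
proof -
  define x1 x2 x3 where x: "x1 = seed_X S $ 1" "x2 = seed_X S $ 2" "x3 = seed_X S $ 3"
  have S': "S = torus_seed w1 w2 w3 p q r (with_y x1 x2 x3)"
    and w: "weight x1 w1" "weight x2 w2" "weight x3 w3"
    and nz: "x1 \<noteq> 0" "x2 \<noteq> 0" "x3 \<noteq> 0"
    and c: "x2 * x1 = x1 * x2" "x3 * x1 = x1 * x3" "x3 * x2 = x2 * x3"
    using S unfolding cluster_seed_def x by blast+
  define y where "y = inverse x3 * (1 + (x1 * x2) * ymon (dot3 w3 r) r)"
  have c12: "x1 * x2 * x3 = x3 * (x1 * x2)" "x1 * (x1 * x2) = x1 * x2 * x1" "x2 * (x1 * x2) = x1 * x2 * x2"
    by (metis c mult.assoc)+
  \<comment> \<open>In \<open>frame\<close> the inverse of \<open>x3\<close> stands to the right of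
    \<open>x1 * x2\<close>, whereas \<open>exchange_relations\<close> expects it on the
    left.\<close>
  have "ymon (dot3 w3 r) 0 * (x1 * x2 * inverse x3) * ymon 0 r = inverse x3 * (x1 * x2) * ymon (dot3 w3 r) r"
    by (simp only: ymon_central mult.assoc commute_inverse[OF c12(1) nz(3), unfolded mult.assoc])
      (simp add: ymon_mult)
  then have T: "T = torus_seed (- w3) w1 w2 (- r) p q (with_y y x1 x2)"
    unfolding T_def S' seed_prev_torus_seed_nonneg[OF r(1)] frame_torus_seed
    by (simp add: y_def with_y_def vector_3_eta vector_3_zero ymon_zero power_int_minus distrib_left mult.assoc add.commute r)
  have X: "seed_X T $ 1 = y" "seed_X T $ 2 = x1" "seed_X T $ 3 = x2"
    by (simp_all add: T with_y_def)
  have "x1 * x2 \<noteq> 0" using nz by simp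
  note rel = exchange_relations[OF w(3) nz(3) c12(1) this _ r(2) y_def]
  have "x1 * y = y * x1" "x2 * y = y * x2"
    unfolding y_def using exchange_commute[OF c(2)[symmetric] nz(3) c12(2) _ w(1) r(3), of 1]
      exchange_commute[OF c(3)[symmetric] nz(3) c12(3) _ w(2) r(4), of 1] by simp_all
  moreover have "weight y (- w3)"
    using exchange_weight[OF w(3) nz(3) weight_mult[OF w(1,2)], of 1 r] weight_one
    unfolding y_def by (simp add: r(5))
  ultimately show "cluster_seed (- w3) w1 w2 (- r) p q T"
    unfolding cluster_seed_def X using w nz c rel by (simp add: T)
  show "seed_X T $ 2 = seed_X S $ 1" "seed_X T $ 3 = seed_X S $ 2"
    "seed_X S $ 3 * seed_X T $ 1 = 1 + seed_X S $ 1 * seed_X S $ 2 * ymon (dot3 w3 r) r"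
    "seed_X T $ 1 * seed_X S $ 3 = 1 + seed_X S $ 1 * seed_X S $ 2 * ymon (- dot3 w3 r) r"
    unfolding X x[symmetric] using rel by simp_all
qed

lemma cluster_seed_prev_nonpos:
  assumes S: "cluster_seed w1 w2 w3 p q (- s) S"
    and s: "\<forall>i. s $ i \<ge> 0" "dot3 w3 s \<noteq> 0" "dot3 w1 s = 0" "dot3 w2 s = 0" "yweight s = w1 + w2"
  defines "T \<equiv> seed_prev (\<iota> qhalf) S"
  shows "cluster_seed (w1 + w2 - w3) w1 w2 s (p - s) (q - s) T"
    and "seed_X T $ 2 = seed_X S $ 1" "seed_X T $ 3 = seed_X S $ 2"
    and "seed_X S $ 3 * seed_X T $ 1 = seed_X S $ 1 * seed_X S $ 2 + ymon (dot3 w3 s) s"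
    and "seed_X T $ 1 * seed_X S $ 3 = seed_X S $ 1 * seed_X S $ 2 + ymon (- dot3 w3 s) s"
proof -
  define x1 x2 x3 where x: "x1 = seed_X S $ 1" "x2 = seed_X S $ 2" "x3 = seed_X S $ 3"
  have S': "S = torus_seed w1 w2 w3 p q (- s) (with_y x1 x2 x3)"
    and w: "weight x1 w1" "weight x2 w2" "weight x3 w3"
    and nz: "x1 \<noteq> 0" "x2 \<noteq> 0" "x3 \<noteq> 0"
    and c: "x2 * x1 = x1 * x2" "x3 * x1 = x1 * x3" "x3 * x2 = x2 * x3"
    using S unfolding cluster_seed_def x by blast+
  define y where "y = inverse x3 * (x1 * x2 + 1 * ymon (dot3 w3 s) s)"
  have c12: "x1 * x2 * x3 = x3 * (x1 * x2)" "x1 * (x1 * x2) = x1 * x2 * x1" "x2 * (x1 * x2) = x1 * x2 * x2"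
    by (metis c mult.assoc)+
  have neg: "\<forall>i. (- s) $ i \<le> 0" "dot3 w1 (- s) = 0" "dot3 w2 (- s) = 0"
    using s by simp_all
  have "ymon (dot3 w3 s) 0 * inverse x3 * ymon 0 s = inverse x3 * ymon (dot3 w3 s) s"
    by (simp only: ymon_central mult.assoc) (simp add: ymon_mult)
  moreover have w': "- w3 - yweight (- s) = w1 + w2 - w3"
    unfolding s(5)[symmetric] by (simp add: vec_eq_iff forall_3 yweight_def)
  moreover have "x1 * (x2 * inverse x3) = inverse x3 * (x1 * x2)"
    using commute_inverse[OF c12(1) nz(3)] by (simp only: mult.assoc)
  ultimately have T: "T = torus_seed (w1 + w2 - w3) w1 w2 s (p - s) (q - s) (with_y y x1 x2)"
    unfolding T_def S' seed_prev_torus_seed_nonpos[OF neg] frame_torus_seed w'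
    by (simp add: y_def with_y_def vector_3_eta vector_3_zero ymon_zero power_int_minus
        distrib_left mult.assoc s)
  have X: "seed_X T $ 1 = y" "seed_X T $ 2 = x1" "seed_X T $ 3 = x2"
    by (simp_all add: T with_y_def)
  note rel = exchange_relations[OF w(3) nz(3) _ _ c12(1) s(2) y_def]
  have "x1 * y = y * x1" "x2 * y = y * x2"
    unfolding y_def using exchange_commute[OF c(2)[symmetric] nz(3) _ c12(2) w(1) s(3), of 1]
      exchange_commute[OF c(3)[symmetric] nz(3) _ c12(3) w(2) s(4), of 1] by simp_all
  moreover have "weight y (w1 + w2 - w3)"
    using exchange_weight[OF w(3) nz(3) weight_one, of "x1 * x2" s] weight_mult[OF w(1,2)]
    unfolding y_def by (simp add: s(5))
  ultimately show "cluster_seed (w1 + w2 - w3) w1 w2 s (p - s) (q - s) T"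
    unfolding cluster_seed_def X using w nz c rel by (simp add: T)
  show "seed_X T $ 2 = seed_X S $ 1" "seed_X T $ 3 = seed_X S $ 2"
    "seed_X S $ 3 * seed_X T $ 1 = seed_X S $ 1 * seed_X S $ 2 + ymon (dot3 w3 s) s"
    "seed_X T $ 1 * seed_X S $ 3 = seed_X S $ 1 * seed_X S $ 2 + ymon (- dot3 w3 s) s"
    unfolding X x[symmetric] using rel by simp_all
qed

section \<open>The two half-infinite sequences of seeds\<close>

lemma seed_X_next [simp]:
  "seed_X (seed_next h S) $ 1 = seed_X S $ 2" "seed_X (seed_next h S) $ 2 = seed_X S $ 3"
  by (simp_all add: seed_next_def reorder_def mutate_def row_perm_def)

lemma seed_X_prev [simp]:
  "seed_X (seed_prev h S) $ 2 = seed_X S $ 1" "seed_X (seed_prev h S) $ 3 = seed_X S $ 2"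
  by (simp_all add: seed_prev_def reorder_def mutate_def row_perm_def)

definition pos_seed where "pos_seed k = (seed_next (\<iota> qhalf) ^^ k) (initial_seed \<iota>)"
definition neg_seed where "neg_seed k = (seed_prev (\<iota> qhalf) ^^ k) (initial_seed \<iota>)"

lemma pos_seed_simps [simp]: "pos_seed 0 = initial_seed \<iota>" "pos_seed (Suc k) = seed_next (\<iota> qhalf) (pos_seed k)"
  and neg_seed_simps [simp]: "neg_seed 0 = initial_seed \<iota>" "neg_seed (Suc k) = seed_prev (\<iota> qhalf) (neg_seed k)"
  by (simp_all add: pos_seed_def neg_seed_def)

text \<open>The offsets make \<open>xp k\<close> equal to X_(k+1) and \<open>xn k\<close> equal to
  X_(-k): the initial seed belongs to index 1, so index -k is reached after \<open>k + 1\<close>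
  backward steps.\<close>

definition "xp k = seed_X (pos_seed k) $ 1"
definition "xn k = seed_X (neg_seed (Suc k)) $ 1"

lemma Xvar_pos: "Xvar \<iota> (int k + 1) = xp k"
  by (simp add: Xvar_def Sigma_seed_def xp_def pos_seed_def)

lemma Xvar_neg: "Xvar \<iota> (- int k) = xn k"
proof -
  have "nat (1 + int k) = Suc k" by simp
  then show ?thesis
    by (simp add: Xvar_def Sigma_seed_def xn_def neg_seed_def)
qed

lemma seed_X_pos_seed: "seed_X (pos_seed k) $ 1 = xp k" "seed_X (pos_seed k) $ 2 = xp (k + 1)"
  "seed_X (pos_seed k) $ 3 = xp (k + 2)"
  by (simp_all add: xp_def numeral_2_eq_2)

lemma seed_X_neg_seed: "seed_X (neg_seed (k + 1)) $ 1 = xn k" "seed_X (neg_seed (k + 2)) $ 2 = xn k"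
  "seed_X (neg_seed (k + 3)) $ 3 = xn k"
  by (simp_all add: xn_def numeral_2_eq_2 numeral_3_eq_3)

lemma xp_initial: "xp 0 = \<iota> (qX 0 (vector [1, 0, 0, 0, 0, 0]))" "xp 1 = \<iota> (qX 0 (vector [0, 1, 0, 0, 0, 0]))"
  "xp 2 = \<iota> (qX 0 (vector [0, 0, 1, 0, 0, 0]))"
  using seed_X_pos_seed[of 0, symmetric] by (simp_all add: initial_seed_def axis_6 numeral_2_eq_2)

lemma \<iota>_eq_0_iff: "\<iota> a = 0 \<longleftrightarrow> a = 0"
  using \<iota>_eq_iff[of a 0] by (simp del: \<iota>_eq_iff)

lemma qX_nonzero: "qX k c \<noteq> 0"
  using qX_mult[of k c "- k - Lam c (- c)" "- c"] by (auto simp: one_qX[symmetric])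

lemma cluster_seed_initial:
  "cluster_seed (vector [-1, 0, 0]) (vector [0, -1, 0]) (vector [0, 0, -1])
     (vector [1, 0, 0]) (vector [0, 1, 0]) (vector [0, 0, 1]) (initial_seed \<iota>)"
proof -
  have X: "seed_X (initial_seed \<iota>) $ 1 = \<iota> (qX 0 (vector [1, 0, 0, 0, 0, 0]))"
    "seed_X (initial_seed \<iota>) $ 2 = \<iota> (qX 0 (vector [0, 1, 0, 0, 0, 0]))"
    "seed_X (initial_seed \<iota>) $ 3 = \<iota> (qX 0 (vector [0, 0, 1, 0, 0, 0]))"
    by (simp_all add: initial_seed_def axis_6)
  have w: "weight (\<iota> (qX 0 (vector [1, 0, 0, 0, 0, 0]))) (vector [-1, 0, 0])"
    "weight (\<iota> (qX 0 (vector [0, 1, 0, 0, 0, 0]))) (vector [0, -1, 0])"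
    "weight (\<iota> (qX 0 (vector [0, 0, 1, 0, 0, 0]))) (vector [0, 0, -1])"
    by (simp_all add: weight_def ymon_def \<iota>_mult[symmetric] qX_vector dot3_def)
  have "initial_seed \<iota> = torus_seed (vector [-1, 0, 0]) (vector [0, -1, 0]) (vector [0, 0, -1])
     (vector [1, 0, 0]) (vector [0, 1, 0]) (vector [0, 0, 1])
     (with_y (\<iota> (qX 0 (vector [1, 0, 0, 0, 0, 0]))) (\<iota> (qX 0 (vector [0, 1, 0, 0, 0, 0]))) (\<iota> (qX 0 (vector [0, 0, 1, 0, 0, 0]))))"
    by (intro qseed.equality)
      (simp_all add: initial_seed_def torus_seed_def with_y_def Lambda0_def B0_def vec_eq_iff forall_6 axis_6 yvar_def)
  then show ?thesis
    unfolding cluster_seed_def X using w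
    by (simp add: \<iota>_mult[symmetric] qX_vector \<iota>_eq_0_iff qX_nonzero)
qed

lemma cluster_seed_cong:
  "cluster_seed w1 w2 w3 p q r S \<Longrightarrow> w1 = w1' \<Longrightarrow> w2 = w2' \<Longrightarrow> w3 = w3' \<Longrightarrow> p = p' \<Longrightarrow> q = q' \<Longrightarrow> r = r' \<Longrightarrow>
    cluster_seed w1' w2' w3' p' q' r' S"
  by simp

lemmas eval_3 = vec_eq_iff forall_3 dot3_def yweight_def

lemma pos_even_conditions:
  fixes i :: int
  assumes "i \<ge> 0"
  defines "w1 \<equiv> vector [i - 1, 0, - i]" and "w2 \<equiv> vector [i, -1, - i]" and "w3 \<equiv> vector [i, 0, - i - 1]"
    and "p \<equiv> vector [i + 1, i, i]"
  shows "\<forall>j. p $ j \<ge> 0" "dot3 w1 p \<noteq> 0" "dot3 w2 p = 0" "dot3 w3 p = 0" "yweight p = w2 + w3" "dot3 w1 p = -1"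
  using assms(1) unfolding assms(2-) by (simp_all add: eval_3 algebra_simps)

lemma pos_odd_conditions:
  fixes i :: int
  assumes "i \<ge> 0"
  defines "w1 \<equiv> vector [i, -1, - i]" and "w2 \<equiv> vector [i, 0, - i - 1]" and "w3 \<equiv> vector [i + 1, -1, - i - 1]"
    and "p \<equiv> vector [i + 1, i + 1, i]"
  shows "\<forall>j. p $ j \<ge> 0" "dot3 w1 p \<noteq> 0" "dot3 w2 p = 0" "dot3 w3 p = 0" "yweight p = w2 + w3" "dot3 w1 p = -1"
  using assms(1) unfolding assms(2-) by (simp_all add: eval_3 algebra_simps)

text \<open>Over two steps the mutated column grows by (1, 1, 1), the primitive imaginary root of
  affine type A_2, and each weight grows by (1, 0, -1). This is the origin of the closed forms and
  of the distinction by parity.\<close>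

lemma cluster_seed_pos:
  fixes i :: nat
  defines "j \<equiv> int i"
  shows "cluster_seed (vector [j - 1, 0, - j]) (vector [j, -1, - j]) (vector [j, 0, - j - 1])
      (vector [j + 1, j, j]) (vector [0, 1, 0]) (vector [- j, - j, 1 - j]) (pos_seed (2 * i))" (is "?E i j")
    and "cluster_seed (vector [j, -1, - j]) (vector [j, 0, - j - 1]) (vector [j + 1, -1, - j - 1])
      (vector [j + 1, j + 1, j]) (vector [1, 0, 1]) (vector [- j - 1, - j, - j]) (pos_seed (2 * i + 1))" (is "?O i j")
proof -
  have odd: "?O i (int i)" if "?E i (int i)" for i
    unfolding Suc_eq_plus1[symmetric] pos_seed_simps
    by (rule cluster_seed_cong[OF cluster_seed_next(1)[OF that pos_even_conditions(1-5)]])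
      (simp_all add: vec_eq_iff forall_3)
  have even: "?E (Suc i) (int (Suc i))" if "?O i (int i)" for i
  proof -
    have "2 * Suc i = Suc (2 * i + 1)" by simp
    then show ?thesis
      unfolding pos_seed_simps
      by (simp only: pos_seed_simps(2))
        (rule cluster_seed_cong[OF cluster_seed_next(1)[OF that pos_odd_conditions(1-5)]];
         simp add: vec_eq_iff forall_3)
  qed
  have "?E i (int i)" for i
  proof (induction i)
    case 0
    then show ?case using cluster_seed_initial by simp
  next
    case (Suc i)
    then show ?case using odd even by blast
  qed
  then show "?E i j" "?O i j"
    using odd unfolding j_def by blast+
qed

definition pos_p :: "nat \<Rightarrow> int ^ 3" where
  "pos_p k = vector [int (k div 2) + 1, int ((k + 1) div 2), int (k div 2)]"

lemma pos_cases:
  obtains w1 w2 w3 q r where "cluster_seed w1 w2 w3 (pos_p k) q r (pos_seed k)"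
    "\<forall>j. pos_p k $ j \<ge> 0" "dot3 w1 (pos_p k) \<noteq> 0" "dot3 w2 (pos_p k) = 0" "dot3 w3 (pos_p k) = 0"
    "yweight (pos_p k) = w2 + w3" "dot3 w1 (pos_p k) = -1"
proof (cases "even k")
  case True
  then obtain i where k: "k = 2 * i" by (elim evenE)
  then have "pos_p k = vector [int i + 1, int i, int i]" by (simp add: pos_p_def add.commute)
  then show ?thesis
    using that cluster_seed_pos(1)[of i] pos_even_conditions[of "int i"] k by (metis of_nat_0_le_iff)
next
  case False
  then obtain i where k: "k = 2 * i + 1" by (elim oddE)
  then have "pos_p k = vector [int i + 1, int i + 1, int i]" by (simp add: pos_p_def add.commute)
  then show ?thesis
    using that cluster_seed_pos(2)[of i] pos_odd_conditions[of "int i"] k by (metis of_nat_0_le_iff)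
qed

lemma xp_facts:
  "xp k \<noteq> 0" "xp (k + 1) * xp k = xp k * xp (k + 1)" "xp (k + 2) * xp k = xp k * xp (k + 2)"
  "xp k * xp (k + 3) = xp (k + 1) * xp (k + 2) + ymon (-1) (pos_p k)"
  "xp (k + 3) * xp k = xp (k + 1) * xp (k + 2) + ymon 1 (pos_p k)"
proof -
  obtain w1 w2 w3 q r where S: "cluster_seed w1 w2 w3 (pos_p k) q r (pos_seed k)"
    and p: "\<forall>j. pos_p k $ j \<ge> 0" "dot3 w1 (pos_p k) \<noteq> 0" "dot3 w2 (pos_p k) = 0" "dot3 w3 (pos_p k) = 0"
    "yweight (pos_p k) = w2 + w3" and d: "dot3 w1 (pos_p k) = -1"
    using pos_cases .
  show "xp k \<noteq> 0" "xp (k + 1) * xp k = xp k * xp (k + 1)" "xp (k + 2) * xp k = xp k * xp (k + 2)"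
    using S unfolding cluster_seed_def seed_X_pos_seed by blast+
  have "seed_X (seed_next (\<iota> qhalf) (pos_seed k)) $ 3 = xp (k + 3)"
    using seed_X_pos_seed(3)[of "k + 1"] by (simp add: eval_nat_numeral)
  then show "xp k * xp (k + 3) = xp (k + 1) * xp (k + 2) + ymon (-1) (pos_p k)"
    "xp (k + 3) * xp k = xp (k + 1) * xp (k + 2) + ymon 1 (pos_p k)"
    using cluster_seed_next(4,5)[OF S p] by (simp_all add: seed_X_pos_seed d)
qed

text \<open>In the first three backward steps the mutated column is a unit vector, for y_3, y_2 and
  y_1 in turn, and each mutation changes its sign. The y-monomial therefore accompanies the product
  of two cluster variables, and after the third step all three columns are negative.\<close>

lemma neg_seed_1:
  "cluster_seed (vector [0, 0, 1]) (vector [-1, 0, 0]) (vector [0, -1, 0])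
     (vector [0, 0, -1]) (vector [1, 0, 0]) (vector [0, 1, 0]) (neg_seed 1)"
  and xn_0: "xp 2 * xn 0 = 1 + xp 0 * xp 1 * ymon (-1) (vector [0, 0, 1])"
  "xn 0 * xp 2 = 1 + xp 0 * xp 1 * ymon 1 (vector [0, 0, 1])"
proof -
  have c: "\<forall>j. (vector [0, 0, 1] :: int ^ 3) $ j \<ge> 0" "dot3 (vector [0, 0, -1]) (vector [0, 0, 1]) \<noteq> 0"
    "dot3 (vector [-1, 0, 0]) (vector [0, 0, 1]) = 0" "dot3 (vector [0, -1, 0]) (vector [0, 0, 1]) = 0"
    "vector [-1, 0, 0] + vector [0, -1, 0] + yweight (vector [0, 0, 1]) = 0"
    "dot3 (vector [0, 0, -1]) (vector [0, 0, 1]) = -1"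
    by (simp_all add: eval_3)
  note prev = cluster_seed_prev_nonneg[OF cluster_seed_initial c(1-5), unfolded c(6)]
  show "cluster_seed (vector [0, 0, 1]) (vector [-1, 0, 0]) (vector [0, -1, 0])
     (vector [0, 0, -1]) (vector [1, 0, 0]) (vector [0, 1, 0]) (neg_seed 1)"
    unfolding One_nat_def neg_seed_simps by (rule cluster_seed_cong[OF prev(1)]) (simp_all add: vec_eq_iff forall_3)
  show "xp 2 * xn 0 = 1 + xp 0 * xp 1 * ymon (-1) (vector [0, 0, 1])"
    "xn 0 * xp 2 = 1 + xp 0 * xp 1 * ymon 1 (vector [0, 0, 1])"
    using prev(4,5) seed_X_pos_seed[of 0] by (simp_all add: xn_def numeral_2_eq_2)
qed

lemma neg_seed_2:
  "cluster_seed (vector [0, 1, 0]) (vector [0, 0, 1]) (vector [-1, 0, 0])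
     (vector [0, -1, 0]) (vector [0, 0, -1]) (vector [1, 0, 0]) (neg_seed 2)"
  and xn_1: "xp 1 * xn 1 = 1 + xn 0 * xp 0 * ymon (-1) (vector [0, 1, 0])"
  "xn 1 * xp 1 = 1 + xn 0 * xp 0 * ymon 1 (vector [0, 1, 0])"
proof -
  have c: "\<forall>j. (vector [0, 1, 0] :: int ^ 3) $ j \<ge> 0" "dot3 (vector [0, -1, 0]) (vector [0, 1, 0]) \<noteq> 0"
    "dot3 (vector [0, 0, 1]) (vector [0, 1, 0]) = 0" "dot3 (vector [-1, 0, 0]) (vector [0, 1, 0]) = 0"
    "vector [0, 0, 1] + vector [-1, 0, 0] + yweight (vector [0, 1, 0]) = 0"
    "dot3 (vector [0, -1, 0]) (vector [0, 1, 0]) = -1"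
    by (simp_all add: eval_3)
  note prev = cluster_seed_prev_nonneg[OF neg_seed_1 c(1-5), unfolded c(6)]
  show "cluster_seed (vector [0, 1, 0]) (vector [0, 0, 1]) (vector [-1, 0, 0])
     (vector [0, -1, 0]) (vector [0, 0, -1]) (vector [1, 0, 0]) (neg_seed 2)"
    unfolding Suc_1[symmetric] neg_seed_simps(2)[of 1]
    by (rule cluster_seed_cong[OF prev(1)]) (simp_all add: vec_eq_iff forall_3)
  show "xp 1 * xn 1 = 1 + xn 0 * xp 0 * ymon (-1) (vector [0, 1, 0])"
    "xn 1 * xp 1 = 1 + xn 0 * xp 0 * ymon 1 (vector [0, 1, 0])"
    using prev(4,5) seed_X_pos_seed[of 0] by (simp_all add: xn_def)
qed

lemma neg_seed_3:
  "cluster_seed (vector [1, 0, 0]) (vector [0, 1, 0]) (vector [0, 0, 1])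
     (vector [-1, 0, 0]) (vector [0, -1, 0]) (vector [0, 0, -1]) (neg_seed 3)"
  and xn_2: "xp 0 * xn 2 = 1 + xn 1 * xn 0 * ymon (-1) (vector [1, 0, 0])"
  "xn 2 * xp 0 = 1 + xn 1 * xn 0 * ymon 1 (vector [1, 0, 0])"
proof -
  have c: "\<forall>j. (vector [1, 0, 0] :: int ^ 3) $ j \<ge> 0" "dot3 (vector [-1, 0, 0]) (vector [1, 0, 0]) \<noteq> 0"
    "dot3 (vector [0, 1, 0]) (vector [1, 0, 0]) = 0" "dot3 (vector [0, 0, 1]) (vector [1, 0, 0]) = 0"
    "vector [0, 1, 0] + vector [0, 0, 1] + yweight (vector [1, 0, 0]) = 0"
    "dot3 (vector [-1, 0, 0]) (vector [1, 0, 0]) = -1"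
    by (simp_all add: eval_3)
  note prev = cluster_seed_prev_nonneg[OF neg_seed_2 c(1-5), unfolded c(6)]
  have "neg_seed 3 = seed_prev (\<iota> qhalf) (neg_seed 2)" by (simp add: eval_nat_numeral)
  then show "cluster_seed (vector [1, 0, 0]) (vector [0, 1, 0]) (vector [0, 0, 1])
     (vector [-1, 0, 0]) (vector [0, -1, 0]) (vector [0, 0, -1]) (neg_seed 3)"
    by (simp only:) (rule cluster_seed_cong[OF prev(1)]; simp add: vec_eq_iff forall_3)
  show "xp 0 * xn 2 = 1 + xn 1 * xn 0 * ymon (-1) (vector [1, 0, 0])"
    "xn 2 * xp 0 = 1 + xn 1 * xn 0 * ymon 1 (vector [1, 0, 0])"
    using prev(4,5) seed_X_pos_seed[of 0] by (simp_all add: xn_def numeral_2_eq_2)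
qed

lemma neg_even_conditions:
  fixes i :: int
  assumes "i \<ge> 0"
  defines "w1 \<equiv> vector [i + 1, 0, - i]" and "w2 \<equiv> vector [i, 1, - i]" and "w3 \<equiv> vector [i, 0, 1 - i]"
    and "s \<equiv> vector [i, i, i + 1]"
  shows "\<forall>j. s $ j \<ge> 0" "dot3 w3 s \<noteq> 0" "dot3 w1 s = 0" "dot3 w2 s = 0" "yweight s = w1 + w2" "dot3 w3 s = 1"
  using assms(1) unfolding assms(2-) by (simp_all add: eval_3 algebra_simps)

lemma neg_odd_conditions:
  fixes i :: int
  assumes "i \<ge> 0"
  defines "w1 \<equiv> vector [i + 1, 1, - i - 1]" and "w2 \<equiv> vector [i + 1, 0, - i]" and "w3 \<equiv> vector [i, 1, - i]"
    and "s \<equiv> vector [i, i + 1, i + 1]"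
  shows "\<forall>j. s $ j \<ge> 0" "dot3 w3 s \<noteq> 0" "dot3 w1 s = 0" "dot3 w2 s = 0" "yweight s = w1 + w2" "dot3 w3 s = 1"
  using assms(1) unfolding assms(2-) by (simp_all add: eval_3 algebra_simps)

lemma cluster_seed_neg:
  fixes i :: nat
  defines "j \<equiv> int i"
  shows "cluster_seed (vector [j + 1, 0, - j]) (vector [j, 1, - j]) (vector [j, 0, 1 - j])
      (vector [j - 1, j, j]) (vector [0, -1, 0]) (- vector [j, j, j + 1]) (neg_seed (2 * i + 3))" (is "?E i j")
    and "cluster_seed (vector [j + 1, 1, - j - 1]) (vector [j + 1, 0, - j]) (vector [j, 1, - j])
      (vector [j, j, j + 1]) (vector [-1, 0, -1]) (- vector [j, j + 1, j + 1]) (neg_seed (2 * i + 4))" (is "?O i j")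
proof -
  have odd: "?O i (int i)" if "?E i (int i)" for i
  proof -
    have "neg_seed (2 * i + 4) = seed_prev (\<iota> qhalf) (neg_seed (2 * i + 3))"
      by (simp add: eval_nat_numeral)
    then show ?thesis
      by (simp only:) (rule cluster_seed_cong[OF cluster_seed_prev_nonpos(1)[OF that neg_even_conditions(1-5)]];
        simp add: vec_eq_iff forall_3)
  qed
  have even: "?E (Suc i) (int (Suc i))" if "?O i (int i)" for i
  proof -
    have "neg_seed (2 * Suc i + 3) = seed_prev (\<iota> qhalf) (neg_seed (2 * i + 4))"
      by (simp add: eval_nat_numeral)
    then show ?thesis
      by (simp only:) (rule cluster_seed_cong[OF cluster_seed_prev_nonpos(1)[OF that neg_odd_conditions(1-5)]];
        simp add: vec_eq_iff forall_3)
  qed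
  have "?E i (int i)" for i
  proof (induction i)
    case 0
    show ?case
      by (simp only: mult_0_right add_0)
        (rule cluster_seed_cong[OF neg_seed_3]; simp add: vec_eq_iff forall_3)
  next
    case (Suc i)
    then show ?case using odd even by blast
  qed
  then show "?E i j" "?O i j"
    using odd unfolding j_def by blast+
qed

definition neg_s :: "nat \<Rightarrow> int ^ 3" where
  "neg_s k = vector [int (k div 2), int ((k + 1) div 2), int (k div 2) + 1]"

lemma neg_cases:
  obtains w1 w2 w3 p q where "cluster_seed w1 w2 w3 p q (- neg_s k) (neg_seed (k + 3))"
    "\<forall>j. neg_s k $ j \<ge> 0" "dot3 w3 (neg_s k) \<noteq> 0" "dot3 w1 (neg_s k) = 0" "dot3 w2 (neg_s k) = 0"
    "yweight (neg_s k) = w1 + w2" "dot3 w3 (neg_s k) = 1"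
proof (cases "even k")
  case True
  then obtain i where k: "k = 2 * i" by (elim evenE)
  then have "neg_s k = vector [int i, int i, int i + 1]" by (simp add: neg_s_def add.commute)
  then show ?thesis
    using that cluster_seed_neg(1)[of i] neg_even_conditions[of "int i"] k by (metis of_nat_0_le_iff)
next
  case False
  then obtain i where k: "k = 2 * i + 1" by (elim oddE)
  then have "neg_s k = vector [int i, int i + 1, int i + 1]" "k + 3 = 2 * i + 4" by (simp_all add: neg_s_def add.commute)
  then show ?thesis
    using that cluster_seed_neg(2)[of i] neg_odd_conditions[of "int i"] by (metis of_nat_0_le_iff)
qed

lemma xn_facts:
  "xn k \<noteq> 0" "xn (k + 1) * xn k = xn k * xn (k + 1)" "xn (k + 2) * xn k = xn k * xn (k + 2)"
  "xn k * xn (k + 3) = xn (k + 1) * xn (k + 2) + ymon 1 (neg_s k)"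
  "xn (k + 3) * xn k = xn (k + 1) * xn (k + 2) + ymon (-1) (neg_s k)"
proof -
  obtain w1 w2 w3 p q where S: "cluster_seed w1 w2 w3 p q (- neg_s k) (neg_seed (k + 3))"
    and p: "\<forall>j. neg_s k $ j \<ge> 0" "dot3 w3 (neg_s k) \<noteq> 0" "dot3 w1 (neg_s k) = 0" "dot3 w2 (neg_s k) = 0"
    "yweight (neg_s k) = w1 + w2" and d: "dot3 w3 (neg_s k) = 1"
    using neg_cases .
  have X: "seed_X (neg_seed (k + 3)) $ 1 = xn (k + 2)" "seed_X (neg_seed (k + 3)) $ 2 = xn (k + 1)"
    "seed_X (neg_seed (k + 3)) $ 3 = xn k"
    using seed_X_neg_seed(1)[of "k + 2"] seed_X_neg_seed(2)[of "k + 1"] seed_X_neg_seed(3)[of k]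
    by (simp_all add: eval_nat_numeral)
  show "xn k \<noteq> 0" "xn (k + 1) * xn k = xn k * xn (k + 1)" "xn (k + 2) * xn k = xn k * xn (k + 2)"
    using S unfolding cluster_seed_def X by metis+
  \<comment> \<open>Along a backward seed the indices of \<open>xn\<close> decrease, so the product
    in the exchange relation first appears in the opposite order.\<close>
  have c: "xn (k + 2) * xn (k + 1) = xn (k + 1) * xn (k + 2)"
    using S unfolding cluster_seed_def X by metis
  have "seed_X (seed_prev (\<iota> qhalf) (neg_seed (k + 3))) $ 1 = xn (k + 3)"
    using seed_X_neg_seed(1)[of "k + 3"] unfolding Suc_eq_plus1[symmetric] neg_seed_simps by simp
  then show "xn k * xn (k + 3) = xn (k + 1) * xn (k + 2) + ymon 1 (neg_s k)"
    "xn (k + 3) * xn k = xn (k + 1) * xn (k + 2) + ymon (-1) (neg_s k)"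
    using cluster_seed_prev_nonpos(4,5)[OF S p] unfolding X d c by (simp_all only:)
qed

section \<open>The elements w, z, u_1 and the first linear relations\<close>

abbreviation "w \<equiv> \<iota> w_elt"
abbreviation "z \<equiv> \<iota> z_elt"

text \<open>All monomials of \<open>w\<close> share one weight, and so do those of \<open>z\<close>.
  Both weights are orthogonal to (1, 1, 1), which is why y-monomials with that exponent commute with
  \<open>w\<close> and \<open>z\<close>.\<close>

lemma weight_w: "weight w (vector [0, 1, -1])"
  and weight_z: "weight z (vector [1, -1, 0])"
  by (simp_all add: weight_def ymon_def w_elt_def z_elt_def dot3_def \<iota>_mult[symmetric]
      distrib_left distrib_right qX_vector algebra_simps)

lemma w_z_relations:
  "ymon k (vector [1, 0, 1]) * w = w * ymon (k + 2) (vector [1, 0, 1])"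
  "ymon k (vector [0, 1, 0]) * w = w * ymon (k - 2) (vector [0, 1, 0])"
  "ymon k (vector [1, 0, 1]) * z = z * ymon (k - 2) (vector [1, 0, 1])"
  "ymon k (vector [0, 1, 0]) * z = z * ymon (k + 2) (vector [0, 1, 0])"
  "ymon k (vector [1, 1, 1]) * w = w * ymon k (vector [1, 1, 1])"
  "ymon k (vector [1, 1, 1]) * z = z * ymon k (vector [1, 1, 1])"
  by (simp_all add: weightD[OF weight_w] weightD[OF weight_z] dot3_def)

text \<open>Of the six monomials in the product, four have the same coefficient in both orders and
  make up \<open>u1_elt\<close>; the other two receive opposite half powers of q.\<close>

lemma u1_relations:
  "w * z = \<iota> u1_elt + ymon (-1) (vector [1, 0, 1]) + ymon 1 (vector [0, 1, 0])"
  "z * w = \<iota> u1_elt + ymon 1 (vector [1, 0, 1]) + ymon (-1) (vector [0, 1, 0])"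
  by (simp_all add: ymon_def \<iota>_mult[symmetric] \<iota>_add[symmetric] u1_elt_def)
    (simp add: w_elt_def z_elt_def distrib_left distrib_right qX_vector add_ac)

lemma xp_1_w: "xp 1 * w = xp 2 + xp 0 * ymon (-1) (vector [0, 1, 0])"
  unfolding xp_initial ymon_def
  by (simp add: \<iota>_mult[symmetric] \<iota>_add[symmetric] w_elt_def distrib_left qX_vector add.commute)

text \<open>Since \<open>xp 3\<close> is not a monomial, the relation is multiplied by
  \<open>xp 0\<close>; the exchange relation then makes it an identity between torus
  elements.\<close>

lemma xp_2_z: "xp 2 * z = xp 3 + xp 1 * ymon (-1) (vector [1, 0, 1])"
proof -
  have "pos_p 0 = vector [1, 0, 0]" by (simp add: pos_p_def)
  then have x3: "xp 0 * xp 3 = xp 1 * xp 2 + ymon (-1) (vector [1, 0, 0])"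
    using xp_facts(4)[of 0] by (simp add: numeral_2_eq_2 One_nat_def)
  have "xp 0 * (xp 2 * z) = xp 1 * xp 2 + ymon (-1) (vector [1, 0, 0]) + xp 0 * (xp 1 * ymon (-1) (vector [1, 0, 1]))"
    unfolding xp_initial ymon_def
    by (simp add: \<iota>_mult[symmetric] \<iota>_add[symmetric] z_elt_def distrib_left qX_vector add_ac)
  also have "\<dots> = xp 0 * (xp 3 + xp 1 * ymon (-1) (vector [1, 0, 1]))"
    by (simp only: x3 distrib_left)
  finally show ?thesis
    using mult_left_cancel[OF xp_facts(1)] by blast
qed

lemma mixed_commute: "xn 0 * xp 1 = xp 1 * xn 0" "xn 0 * xp 0 = xp 0 * xn 0" "xn 1 * xp 0 = xp 0 * xn 1"
proof -
  have X: "seed_X (neg_seed 1) $ 1 = xn 0" "seed_X (neg_seed 1) $ 2 = xp 0" "seed_X (neg_seed 1) $ 3 = xp 1"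
    "seed_X (neg_seed 2) $ 1 = xn 1" "seed_X (neg_seed 2) $ 3 = xp 0"
    using seed_X_pos_seed[of 0] by (simp_all add: xn_def numeral_2_eq_2)
  show "xn 0 * xp 1 = xp 1 * xn 0" "xn 0 * xp 0 = xp 0 * xn 0" "xn 1 * xp 0 = xp 0 * xn 1"
    using neg_seed_1 neg_seed_2 unfolding cluster_seed_def X by metis+
qed

text \<open>This begins the passage across the gap: the argument of \<open>linear\<close> is run
  backward, now with an exchange relation in which the y-monomial accompanies a product. Each later
  relation comes in the same way from the one two indices higher, until \<open>xn_1_z\<close> and
  \<open>xn_2_w\<close> can start the backward sequence.\<close>

lemma xp_0_z: "xp 0 * z = xp 1 + xn 0 * ymon (-1) (vector [1, 0, 0])"
proof -
  have "pos_p 0 = vector [1, 0, 0]" by (simp add: pos_p_def)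
  then have x3: "xp 0 * xp 3 = xp 1 * xp 2 + ymon (-1) (vector [1, 0, 0])"
    using xp_facts(4)[of 0] by (simp add: numeral_2_eq_2 One_nat_def)
  have y: "ymon (-1) (vector [0, 0, 1]) * ymon (-1) (vector [1, 0, 0]) = ymon (-1) (vector [1, 0, 1])"
  proof -
    have "vector [0, 0, 1] + vector [1, 0, 0] = (vector [1, 0, 1] :: int ^ 3)"
      by (simp add: vec_eq_iff forall_3)
    then show ?thesis by (simp add: ymon_mult dot3_def yweight_def)
  qed
  have c: "xp 2 * xp 0 = xp 0 * xp 2" "xp 2 * xp 1 = xp 1 * xp 2"
    using xp_facts(3)[of 0] xp_facts(2)[of 1] by (simp_all add: numeral_2_eq_2 One_nat_def)
  have "xp 2 * (xp 0 * z) = xp 0 * (xp 2 * z)"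
    by (simp only: mult.assoc[symmetric] c)
  also have "\<dots> = xp 0 * xp 3 + xp 0 * xp 1 * ymon (-1) (vector [1, 0, 1])"
    by (simp only: xp_2_z distrib_left mult.assoc)
  also have "\<dots> = xp 2 * xp 1 + xp 2 * xn 0 * ymon (-1) (vector [1, 0, 0])"
    by (simp only: x3 c xn_0 distrib_right mult_1_left mult.assoc y add.assoc)
  also have "\<dots> = xp 2 * (xp 1 + xn 0 * ymon (-1) (vector [1, 0, 0]))"
    by (simp only: distrib_left mult.assoc)
  finally show ?thesis
    using mult_left_cancel[OF xp_facts(1)] by blast
qed

lemma xn_0_w: "xn 0 * w = xn 1 + xp 0 * ymon 1 (vector [0, 0, 1])"
proof -
  have c: "xp 1 * xp 0 = xp 0 * xp 1"
    using xp_facts(2)[of 0] by simp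
  have "xp 1 * (xn 0 * w) = xn 0 * (xp 1 * w)"
    by (simp only: mult.assoc[symmetric] mixed_commute)
  also have "\<dots> = xn 0 * xp 2 + xn 0 * xp 0 * ymon (-1) (vector [0, 1, 0])"
    by (simp only: xp_1_w distrib_left mult.assoc)
  \<comment> \<open>The constant 1 from \<open>xn 0 * xp 2\<close> joins the other y-term to form
    \<open>xp 1 * xn 1\<close>.\<close>
  also have "\<dots> = xp 1 * xn 1 + xp 1 * xp 0 * ymon 1 (vector [0, 0, 1])"
    by (simp only: xn_0 xn_1 c) (simp only: add_ac)
  also have "\<dots> = xp 1 * (xn 1 + xp 0 * ymon 1 (vector [0, 0, 1]))"
    by (simp only: distrib_left mult.assoc)
  finally show ?thesis
    using mult_left_cancel[OF xp_facts(1)] by blast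
qed

lemma xn_1_z: "xn 1 * z = xn 2 + xn 0 * ymon 1 (vector [0, 1, 0])"
proof -
  have "xp 0 * (xn 1 * z) = xn 1 * (xp 0 * z)"
    by (simp only: mult.assoc[symmetric] mixed_commute)
  also have "\<dots> = xn 1 * xp 1 + xn 1 * xn 0 * ymon (-1) (vector [1, 0, 0])"
    by (simp only: xp_0_z distrib_left mult.assoc)
  also have "\<dots> = xp 0 * xn 2 + xp 0 * xn 0 * ymon 1 (vector [0, 1, 0])"
    by (simp only: xn_1 xn_2 mixed_commute) (simp only: add_ac)
  also have "\<dots> = xp 0 * (xn 2 + xn 0 * ymon 1 (vector [0, 1, 0]))"
    by (simp only: distrib_left mult.assoc)
  finally show ?thesis
    using mult_left_cancel[OF xp_facts(1)] by blast
qed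

lemma xn_2_w: "xn 2 * w = xn 3 + xn 1 * ymon 1 (vector [1, 0, 1])"
proof -
  have "neg_s 0 = vector [0, 0, 1]" by (simp add: neg_s_def)
  then have x3: "xn 0 * xn 3 = xn 1 * xn 2 + ymon 1 (vector [0, 0, 1])"
    using xn_facts(4)[of 0] by (simp add: numeral_2_eq_2 One_nat_def)
  have y: "ymon 1 (vector [1, 0, 0]) * ymon 1 (vector [0, 0, 1]) = ymon 1 (vector [1, 0, 1])"
  proof -
    have "vector [1, 0, 0] + vector [0, 0, 1] = (vector [1, 0, 1] :: int ^ 3)"
      by (simp add: vec_eq_iff forall_3)
    then show ?thesis by (simp add: ymon_mult dot3_def yweight_def)
  qed
  have c: "xn 2 * xn 0 = xn 0 * xn 2" "xn 2 * xn 1 = xn 1 * xn 2" "xn 1 * xn 0 = xn 0 * xn 1"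
    using xn_facts(3)[of 0] xn_facts(2)[of 1] xn_facts(2)[of 0] by (simp_all add: numeral_2_eq_2 One_nat_def)
  have "xn 0 * (xn 2 * w) = xn 2 * (xn 0 * w)"
    by (simp only: mult.assoc[symmetric] c)
  also have "\<dots> = xn 2 * xn 1 + xn 2 * xp 0 * ymon 1 (vector [0, 0, 1])"
    by (simp only: xn_0_w distrib_left mult.assoc)
  also have "\<dots> = xn 0 * xn 3 + xn 0 * xn 1 * ymon 1 (vector [1, 0, 1])"
    by (simp only: x3 c xn_2 distrib_right mult_1_left mult.assoc y add.assoc)
  also have "\<dots> = xn 0 * (xn 3 + xn 1 * ymon 1 (vector [1, 0, 1]))"
    by (simp only: distrib_left mult.assoc)
  finally show ?thesis
    using mult_left_cancel[OF xn_facts(1)] by blast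
qed

section \<open>The two instances of the abstract scheme\<close>

definition "V = ymon 0 (vector [1, 1, 1])"
text \<open>This is the step from one exchange exponent to the next, in \<open>pos_p\<close> as well
  as in \<open>neg_s\<close>.\<close>

definition "c_exp k = (vector (if even k then [1, 0, 1] else [0, 1, 0]) :: int ^ 3)" for k :: nat
text \<open>In terms of the index of X, \<open>z\<close> belongs to odd and \<open>w\<close> to even
  indices; \<open>p_pos\<close> and \<open>p_neg\<close> look opposite because \<open>xp k\<close>
  is X_(k+1) while \<open>xn k\<close> is X_(-k).\<close>

definition "p_pos k = (if even k then z else w)" for k :: nat
definition "p_neg k = (if even k then w else z)" for k :: nat

lemma pos_p_step: "pos_p (k + 2) = pos_p k + vector [1, 1, 1]" "pos_p (k + 1) = pos_p k + c_exp (k + 1)"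
  "dot3 (yweight (pos_p k)) (vector [1, 1, 1]) = -2" "dot3 (yweight (pos_p k)) (c_exp (k + 1)) = -1"
  by (cases "even k"; auto simp: pos_p_def c_exp_def vec_eq_iff forall_3 dot3_def yweight_def elim!: evenE oddE)+

lemma neg_s_step: "neg_s (k + 2) = neg_s k + vector [1, 1, 1]" "neg_s (k + 1) = neg_s k + c_exp (k + 1)"
  "dot3 (yweight (neg_s k)) (vector [1, 1, 1]) = 2" "dot3 (yweight (neg_s k)) (c_exp (k + 1)) = 1"
  by (cases "even k"; auto simp: neg_s_def c_exp_def vec_eq_iff forall_3 dot3_def yweight_def elim!: evenE oddE)+

lemma c_exp_add: "c_exp k + c_exp (k + 1) = vector [1, 1, 1]" "dot3 (yweight (c_exp k)) (c_exp (k + 1)) = 0"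
  by (auto simp: c_exp_def vec_eq_iff forall_3 dot3_def yweight_def)

lemma u_elt_step: "\<iota> (u_elt (k + 3)) = \<iota> u1_elt * \<iota> (u_elt (k + 2)) - V * \<iota> (u_elt (k + 1))"
  and u_elt_2: "\<iota> (u_elt 2) = (\<iota> u1_elt)\<^sup>2 - 2 * V"
proof -
  have two: "\<iota> 2 = 2"
    using \<iota>_add[of 1 1] by simp
  show "\<iota> (u_elt (k + 3)) = \<iota> u1_elt * \<iota> (u_elt (k + 2)) - V * \<iota> (u_elt (k + 1))"
    "\<iota> (u_elt 2) = (\<iota> u1_elt)\<^sup>2 - 2 * V"
    by (simp_all add: V_def ymon_def eval_nat_numeral \<iota>_mult \<iota>_diff two)
qed

lemma V_u1: "V * \<iota> u1_elt = \<iota> u1_elt * V"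
proof -
  have "V * w = w * V" "V * z = z * V"
    using w_z_relations(5,6)[of 0] by (simp_all only: V_def)
  then have wz: "V * (w * z) = w * z * V"
    by (metis mult.assoc)
  have c: "V * ymon k (c_exp j) = ymon k (c_exp j) * V" for k j
    unfolding V_def ymon_mult
    by (simp add: add.commute) (simp add: c_exp_def dot3_def yweight_def)
  have e: "\<iota> u1_elt = w * z - ymon (-1) (c_exp 0) - ymon 1 (c_exp 1)"
    by (simp add: u1_relations c_exp_def)
  show ?thesis
    unfolding e by (simp only: right_diff_distrib left_diff_distrib wz c)
qed

text \<open>The value \<rho> = q compensates the pairing -2 of \<open>pos_p k\<close> with (1, 1, 1)
  in \<open>pos_p_step\<close>. Backward this pairing is 2, and \<rho> becomes the inverse of
  q.\<close>

sublocale pos: exchange_sequence xp p_pos "\<lambda>k. ymon (-1) (c_exp k)" "\<lambda>k. ymon 1 (c_exp k)"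
  "\<lambda>k. ymon (-1) (pos_p k)" "\<lambda>k. ymon 1 (pos_p k)" "\<lambda>k. \<iota> (u_elt k)" "ymon 2 0" V "\<iota> u1_elt"
proof unfold_locales
  fix k
  show "xp k \<noteq> 0" "xp (k + 1) * xp k = xp k * xp (k + 1)" "xp (k + 2) * xp k = xp k * xp (k + 2)"
    "xp k * xp (k + 3) = xp (k + 1) * xp (k + 2) + ymon (-1) (pos_p k)"
    "xp (k + 3) * xp k = xp (k + 1) * xp (k + 2) + ymon 1 (pos_p k)"
    by (rule xp_facts)+
  show "ymon 1 (pos_p k) * ymon (-1) (c_exp (k + 1)) = ymon (-1) (pos_p (k + 1))"
    unfolding pos_p_step(2) ymon_mult pos_p_step(4) by simp
  show "xp 1 * p_pos 1 = xp 2 + xp 0 * ymon (-1) (c_exp 1)"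
    using xp_1_w by (simp add: p_pos_def c_exp_def)
  show "xp 2 * p_pos 2 = xp 3 + xp 1 * ymon (-1) (c_exp 2)"
    using xp_2_z by (simp add: p_pos_def c_exp_def)
  show "p_pos (k + 2) = p_pos k" "ymon (-1) (c_exp (k + 2)) = ymon (-1) (c_exp k)"
    by (simp_all add: p_pos_def c_exp_def)
  show "ymon (-1) (c_exp k) * p_pos (k + 1) = p_pos (k + 1) * ymon 1 (c_exp k)"
    using w_z_relations[of "-1"] by (simp add: p_pos_def c_exp_def)
  show "ymon (-1) (c_exp k) * ymon 1 (c_exp (k + 1)) = V"
    unfolding ymon_mult c_exp_add V_def by simp
  show "p_pos k * p_pos (k + 1) = \<iota> u1_elt + ymon (-1) (c_exp (k + 1)) + ymon 1 (c_exp k)"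
    using u1_relations by (simp add: p_pos_def c_exp_def add_ac)
  show "ymon (-1) (pos_p (k + 2)) = ymon 2 0 * ymon (-1) (pos_p k) * V"
    unfolding pos_p_step(1) V_def ymon_mult by (simp add: pos_p_step(3))
  show "ymon 2 0 * x = x * ymon 2 0" for x
    by (rule ymon_central)
  show "V * p_pos k = p_pos k * V"
    using w_z_relations(5,6) by (simp add: p_pos_def V_def)
  show "V * \<iota> u1_elt = \<iota> u1_elt * V"
    by (rule V_u1)
  show "\<iota> (u_elt 0) = 1" "\<iota> (u_elt 1) = \<iota> u1_elt"
    by simp_all
  show "\<iota> (u_elt 2) = (\<iota> u1_elt)\<^sup>2 - 2 * V"
    by (rule u_elt_2)
  show "\<iota> (u_elt (k + 3)) = \<iota> u1_elt * \<iota> (u_elt (k + 2)) - V * \<iota> (u_elt (k + 1))"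
    by (rule u_elt_step)
qed

sublocale neg: exchange_sequence xn p_neg "\<lambda>k. ymon 1 (c_exp k)" "\<lambda>k. ymon (-1) (c_exp k)"
  "\<lambda>k. ymon 1 (neg_s k)" "\<lambda>k. ymon (-1) (neg_s k)" "\<lambda>k. \<iota> (u_elt k)" "ymon (-2) 0" V "\<iota> u1_elt"
proof unfold_locales
  fix k
  show "xn k \<noteq> 0" "xn (k + 1) * xn k = xn k * xn (k + 1)" "xn (k + 2) * xn k = xn k * xn (k + 2)"
    "xn k * xn (k + 3) = xn (k + 1) * xn (k + 2) + ymon 1 (neg_s k)"
    "xn (k + 3) * xn k = xn (k + 1) * xn (k + 2) + ymon (-1) (neg_s k)"
    by (rule xn_facts)+
  show "ymon (-1) (neg_s k) * ymon 1 (c_exp (k + 1)) = ymon 1 (neg_s (k + 1))"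
    unfolding neg_s_step(2) ymon_mult neg_s_step(4) by simp
  show "xn 1 * p_neg 1 = xn 2 + xn 0 * ymon 1 (c_exp 1)"
    using xn_1_z by (simp add: p_neg_def c_exp_def)
  show "xn 2 * p_neg 2 = xn 3 + xn 1 * ymon 1 (c_exp 2)"
    using xn_2_w by (simp add: p_neg_def c_exp_def)
  show "p_neg (k + 2) = p_neg k" "ymon 1 (c_exp (k + 2)) = ymon 1 (c_exp k)"
    by (simp_all add: p_neg_def c_exp_def)
  show "ymon 1 (c_exp k) * p_neg (k + 1) = p_neg (k + 1) * ymon (-1) (c_exp k)"
    using w_z_relations[of 1] by (simp add: p_neg_def c_exp_def)
  show "ymon 1 (c_exp k) * ymon (-1) (c_exp (k + 1)) = V"
    unfolding ymon_mult c_exp_add V_def by simp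
  show "p_neg k * p_neg (k + 1) = \<iota> u1_elt + ymon 1 (c_exp (k + 1)) + ymon (-1) (c_exp k)"
    using u1_relations by (simp add: p_neg_def c_exp_def add_ac)
  show "ymon 1 (neg_s (k + 2)) = ymon (-2) 0 * ymon 1 (neg_s k) * V"
    unfolding neg_s_step(1) V_def ymon_mult by (simp add: neg_s_step(3))
  show "ymon (-2) 0 * x = x * ymon (-2) 0" for x
    by (rule ymon_central)
  show "V * p_neg k = p_neg k * V"
    using w_z_relations(5,6) by (simp add: p_neg_def V_def)
  show "V * \<iota> u1_elt = \<iota> u1_elt * V"
    by (rule V_u1)
  show "\<iota> (u_elt 0) = 1" "\<iota> (u_elt 1) = \<iota> u1_elt"
    by simp_all
  show "\<iota> (u_elt 2) = (\<iota> u1_elt)\<^sup>2 - 2 * V"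
    by (rule u_elt_2)
  show "\<iota> (u_elt (k + 3)) = \<iota> u1_elt * \<iota> (u_elt (k + 2)) - V * \<iota> (u_elt (k + 1))"
    by (rule u_elt_step)
qed

section \<open>From normalised monomials to the ordered products of the theorem\<close>

abbreviation "h \<equiv> \<iota> qhalf"
abbreviation "Y \<equiv> yvar \<iota> 1 * yvar \<iota> 2 * yvar \<iota> 3"

lemma h_powi: "h powi k = ymon k 0"
proof -
  have "k *s (0 :: int ^ 3) = 0" by (simp add: vec_eq_iff)
  then show ?thesis by (simp add: qhalf_ymon ymon_powi)
qed

lemma Y_powi: "Y powi k = ymon (-3 * k) (vector [k, k, k])"
proof -
  have "vector [1, 0, 0] + vector [0, 1, 0] + vector [0, 0, 1] = (vector [1, 1, 1] :: int ^ 3)"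
    "k *s vector [1, 1, 1] = (vector [k, k, k] :: int ^ 3)"
    by (simp_all add: vec_eq_iff forall_3)
  then show ?thesis
    by (simp add: yvar_ymon ymon_mult ymon_powi) (simp add: dot3_def yweight_def mult.commute)
qed

lemma V_power: "V ^ l = ymon 0 (vector [int l, int l, int l])"
proof -
  have "int l *s vector [1, 1, 1] = (vector [int l, int l, int l] :: int ^ 3)"
    by (simp_all add: vec_eq_iff forall_3)
  then show ?thesis by (simp add: V_def ymon_power)
qed

lemma sum_int_atMost: "(\<Sum>l = 0..int k. f l) = (\<Sum>l\<le>k. f (int l))" for f :: "int \<Rightarrow> 'f"
proof -
  have "{0..int k} = int ` {..k}"
    using image_int_atLeastAtMost[of 0 k] by (simp add: atMost_atLeast0)
  then show ?thesis by (simp add: sum.reindex)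
qed

text \<open>The factor \<open>ymon (3 * int l) 0\<close> offsets the normalisation
  \<open>Y powi l\<close>, which is \<open>V ^ l\<close> times \<open>q^(-3l/2)\<close>. For
  \<open>t\<close> equal to 0 or 1 the bound \<open>N div 2\<close> is -1 and the sum is empty, in
  agreement with the initial zeros of \<open>T\<close>.\<close>

lemma weighted_sum:
  fixes T :: "nat \<Rightarrow> 'f"
  assumes T: "T 0 = 0" "T 1 = 0" "\<And>s. T (s + 2) = (\<Sum>l\<le>s div 2. C l * \<iota> (u_elt (s - 2 * l)) * V ^ l)"
    and g: "\<And>l. (\<Sum>i = 0..int l. h powi (g i (int l))) = ymon e 0 * C l * ymon (3 * int l) 0"
    and N: "N = int t - 2"
  shows "(\<Sum>l = 0..N div 2. (\<Sum>i = 0..l. h powi (g i l)) * \<iota> (u_elt (nat (N - 2 * l))) * Y powi l) = ymon e 0 * T t"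
proof -
  consider "t = 0" | "t = 1" | s where "t = s + 2"
    by (metis One_nat_def add_2_eq_Suc' not0_implies_Suc)
  then show ?thesis
  proof cases
    case (3 s)
    have N: "N = int s" and N2: "N div 2 = int (s div 2)"
      using N 3 by auto
    have "(\<Sum>i = 0..int l. h powi (g i (int l))) * \<iota> (u_elt (nat (N - 2 * int l))) * Y powi (int l)
      = ymon e 0 * (C l * \<iota> (u_elt (s - 2 * l)) * V ^ l)" for l
    proof -
      have u: "nat (N - 2 * int l) = s - 2 * l" by (simp add: N nat_diff_distrib')
      have "ymon (3 * int l) 0 * \<iota> (u_elt (s - 2 * l)) * Y powi (int l)
        = \<iota> (u_elt (s - 2 * l)) * (ymon (3 * int l) 0 * ymon (- 3 * int l) (vector [int l, int l, int l]))"
        unfolding Y_powi ymon_central[of "3 * int l" "\<iota> (u_elt (s - 2 * l))"] by (simp only: mult.assoc)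
      also have "\<dots> = \<iota> (u_elt (s - 2 * l)) * V ^ l"
        by (simp add: ymon_mult V_power)
      finally show ?thesis
        unfolding g u by (simp only: mult.assoc)
    qed
    then show ?thesis
      unfolding N2 sum_int_atMost 3 T(3) sum_distrib_left by simp
  qed (use N T in simp_all)
qed

lemma pos_sum:
  assumes "\<And>i l. g i l = 2 * i + e + 3 * l" and "N = int t - 2"
  shows "(\<Sum>l = 0..N div 2. (\<Sum>i = 0..l. h powi (g i l)) * \<iota> (u_elt (nat (N - 2 * l))) * Y powi l)
    = ymon e 0 * pos.T t"
proof (rule weighted_sum[OF _ _ pos.T_sum _ assms(2)])
  fix l
  have z: "n *s (0 :: int ^ 3) = 0" for n by (simp add: vec_eq_iff)
  show "(\<Sum>i = 0..int l. h powi g i (int l)) = ymon e 0 * (\<Sum>i\<le>l. ymon 2 0 ^ i) * ymon (3 * int l) 0"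
    unfolding sum_int_atMost sum_distrib_left sum_distrib_right assms(1)
    by (intro sum.cong refl) (simp add: h_powi ymon_power ymon_mult z algebra_simps)
qed simp_all

text \<open>Replacing \<open>i\<close> by \<open>l - i\<close> changes the exponent
  \<open>2 * i + e + l\<close> into \<open>e + 3 * l - 2 * i\<close>. This exhibits the powers of
  \<rho> = q^(-1) and explains why the backward formulas contain \<open>l\<close> where the forward
  ones contain \<open>3 * l\<close>.\<close>

lemma neg_sum:
  assumes "\<And>i l. g i l = 2 * i + e + l" and "N = int t - 2"
  shows "(\<Sum>l = 0..N div 2. (\<Sum>i = 0..l. h powi (g i l)) * \<iota> (u_elt (nat (N - 2 * l))) * Y powi l)
    = ymon e 0 * neg.T t"
proof (rule weighted_sum[OF _ _ neg.T_sum _ assms(2)])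
  fix l
  have z: "n *s (0 :: int ^ 3) = 0" for n by (simp add: vec_eq_iff)
  have "(\<Sum>i\<le>l. h powi g (int i) (int l)) = (\<Sum>i\<le>l. h powi g (int (l - i)) (int l))"
    using sum.atLeastAtMost_rev[of "\<lambda>i. h powi g (int i) (int l)" 0 l] by (simp add: atMost_atLeast0)
  also have "\<dots> = ymon e 0 * (\<Sum>i\<le>l. ymon (-2) 0 ^ i) * ymon (3 * int l) 0"
    unfolding sum_distrib_left sum_distrib_right assms(1)
    by (intro sum.cong refl) (simp add: h_powi ymon_power ymon_mult z of_nat_diff algebra_simps)
  finally show "(\<Sum>i = 0..int l. h powi g i (int l)) = ymon e 0 * (\<Sum>i\<le>l. ymon (-2) 0 ^ i) * ymon (3 * int l) 0"
    unfolding sum_int_atMost .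
qed simp_all

section \<open>Membership in the quantum cluster algebra\<close>

abbreviation "A \<equiv> quantum_cluster_algebra \<iota>"

lemma A_zero: "0 \<in> A"
  using quantum_cluster_algebra.diff[OF quantum_cluster_algebra.one quantum_cluster_algebra.one] by simp

lemma A_add: "a \<in> A \<Longrightarrow> b \<in> A \<Longrightarrow> a + b \<in> A"
  using quantum_cluster_algebra.diff[of a \<iota> "0 - b"] quantum_cluster_algebra.diff[OF A_zero, of b] by simp

lemma A_power: "a \<in> A \<Longrightarrow> a ^ n \<in> A"
  by (induction n) (auto intro: quantum_cluster_algebra.one quantum_cluster_algebra.mult)

lemma A_powi: "a \<in> A \<Longrightarrow> inverse a \<in> A \<Longrightarrow> a powi n \<in> A"
  by (auto simp: power_int_def A_power)

lemma A_ymon: "ymon k d \<in> A"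
proof -
  have s: "d $ 1 *s vector [1, 0, 0] + d $ 2 *s vector [0, 1, 0] + d $ 3 *s vector [0, 0, 1] = d"
    by (simp add: vec_eq_iff forall_3)
  have "\<exists>e. yvar \<iota> 1 powi (d $ 1) * yvar \<iota> 2 powi (d $ 2) * yvar \<iota> 3 powi (d $ 3) = ymon e d"
    by (simp add: yvar_ymon ymon_powi ymon_mult s) blast
  then obtain e where e: "yvar \<iota> 1 powi (d $ 1) * yvar \<iota> 2 powi (d $ 2) * yvar \<iota> 3 powi (d $ 3) = ymon e d" ..
  have "h powi (k - e) * (yvar \<iota> 1 powi (d $ 1) * yvar \<iota> 2 powi (d $ 2) * yvar \<iota> 3 powi (d $ 3)) \<in> A"
    by (intro quantum_cluster_algebra.mult A_powi quantum_cluster_algebra.y quantum_cluster_algebra.y_inv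
        quantum_cluster_algebra.q_half quantum_cluster_algebra.q_half_inv)
  then show ?thesis
    by (simp add: e h_powi ymon_mult)
qed

lemmas A_intros = quantum_cluster_algebra.mult quantum_cluster_algebra.diff A_add A_ymon

lemma A_initial: "xp 0 \<in> A" "xp 1 \<in> A" "xp 2 \<in> A" "xp 3 \<in> A" "xn 0 \<in> A"
proof -
  note r = mutation_reachable.initial[of \<iota>]
  have "seed_X (initial_seed \<iota>) $ row3 k \<in> A" "seed_X (mutate h j (initial_seed \<iota>)) $ row3 k \<in> A" for j k
    by (intro quantum_cluster_algebra.cluster mutation_reachable.mutate r)+
  from this(1)[of 1] this(1)[of 2] this(1)[of 3] this(2)[of 1 1] this(2)[of 3 3]
  show "xp 0 \<in> A" "xp 1 \<in> A" "xp 2 \<in> A" "xp 3 \<in> A" "xn 0 \<in> A"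
    using seed_X_pos_seed[of 0]
    by (simp_all add: numeral_2_eq_2 numeral_3_eq_3 xp_def xn_def)
      (simp_all add: seed_next_def seed_prev_def reorder_def row_perm_def)
qed

text \<open>The element \<open>w\<close> is itself a cluster variable, the one that replaces X_2
  when the initial seed is mutated in direction 2.\<close>

lemma A_w: "w \<in> A"
proof -
  let ?S = "initial_seed \<iota>"
  have S: "?S = torus_seed (vector [-1, 0, 0]) (vector [0, -1, 0]) (vector [0, 0, -1])
     (vector [1, 0, 0]) (vector [0, 1, 0]) (vector [0, 0, 1]) (with_y (xp 0) (xp 1) (xp 2))"
    using cluster_seed_initial seed_X_pos_seed[of 0] unfolding cluster_seed_def by (simp add: numeral_2_eq_2)
  have b: "(\<chi> i. max (seed_b ?S $ i $ 2) 0) - axis (row3 2) 1 = vector [1, -1, 0, 0, 1, 0]"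
    "(\<chi> i. max (- (seed_b ?S $ i $ 2)) 0) - axis (row3 2) 1 = vector [0, -1, 1, 0, 0, 0]"
    by (simp_all add: vec_eq_iff forall_6 initial_seed_def B0_def axis_def)
  have "seed_X (mutate h 2 ?S) $ row3 2 = frame h ?S (vector [1, -1, 0, 0, 1, 0]) + frame h ?S (vector [0, -1, 1, 0, 0, 0])"
    unfolding mutate_def b by simp
  also have "\<dots> = w"
  proof -
    have i: "inverse (xp 1) = \<iota> (qX 0 (vector [0, -1, 0, 0, 0, 0]))"
    proof (rule inverse_unique)
      have "vector [0, 0, 0, 0, 0, 0] = (0 :: int ^ 6)" by (simp add: vec_eq_iff forall_6)
      then show "xp 1 * \<iota> (qX 0 (vector [0, -1, 0, 0, 0, 0])) = 1"
        unfolding xp_initial by (simp add: \<iota>_mult[symmetric] qX_vector one_qX[symmetric])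
    qed
    show ?thesis
      unfolding S frame_torus_seed power_int_minus power_int_1_right power_int_0_right i
      unfolding xp_initial
      by (simp add: ymon_def dot3_def \<iota>_mult[symmetric] \<iota>_add[symmetric] qX_vector w_elt_def)
  qed
  finally show ?thesis
    by (metis quantum_cluster_algebra.cluster mutation_reachable.initial mutation_reachable.mutate)
qed

text \<open>\<open>z\<close> becomes an element of the algebra when multiplied from the left by \<open>X\<^sub>1\<close> or \<open>X\<^sub>3\<close>, and the exchange
  relation \<open>X\<^sub>4 X\<^sub>1 = X\<^sub>2 X\<^sub>3 + q\<^bsup>1/2\<^esup> y\<^sub>1\<close> writes a unit as a combination of \<open>X\<^sub>1\<close> and \<open>X\<^sub>3\<close>.\<close>

lemma A_z: "z \<in> A"
proof -
  have "pos_p 0 = vector [1, 0, 0]" by (simp add: pos_p_def)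
  then have x3: "xp 3 * xp 0 = xp 2 * xp 1 + ymon 1 (vector [1, 0, 0])"
    using xp_facts(5)[of 0] xp_facts(2)[of 1] by (simp add: numeral_2_eq_2 One_nat_def)
  have "ymon 1 (vector [1, 0, 0]) * z = xp 3 * (xp 0 * z) - xp 2 * (xp 1 * z)"
    by (simp only: mult.assoc[symmetric] x3 distrib_right) simp
  \<comment> \<open>Membership is available for \<open>xp 0 * z\<close> and \<open>xp 2 * z\<close>,
    so \<open>xp 2\<close> has to stand next to \<open>z\<close>.\<close>
  also have "xp 2 * (xp 1 * z) = xp 1 * (xp 2 * z)"
    using xp_facts(2)[of 1] by (simp add: mult.assoc[symmetric] numeral_2_eq_2 One_nat_def)
  finally have "ymon 1 (vector [1, 0, 0]) * z \<in> A"
    unfolding xp_0_z xp_2_z by (simp only:) (intro A_intros A_initial)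
  then have "ymon (-1) (- vector [1, 0, 0]) * (ymon 1 (vector [1, 0, 0]) * z) \<in> A"
    by (rule quantum_cluster_algebra.mult[OF A_ymon])
  moreover have "ymon (-1) (- vector [1, 0, 0]) * (ymon 1 (vector [1, 0, 0]) * z) = z"
    by (simp add: mult.assoc[symmetric] ymon_mult) (simp add: dot3_def yweight_def ymon_zero)
  ultimately show ?thesis by metis
qed

text \<open>The seeds of index m involve reorderings, which \<open>mutation_reachable\<close> does
  not contain. Membership is therefore spread from a few variables reached by at most one mutation,
  along linear relations whose coefficients are \<open>w\<close>, \<open>z\<close> and
  monomials.\<close>

lemma A_linear_recurrence:
  fixes a p c :: "nat \<Rightarrow> 'f"
  assumes "a 0 \<in> A" "a 1 \<in> A"
    and "\<And>k. a (k + 1) * p (k + 1) = a (k + 2) + a k * c (k + 1)"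
    and "\<And>k. p k \<in> A" "\<And>k. c k \<in> A"
  shows "a k \<in> A"
proof (induction k rule: induct_nat_012)
  case (ge2 n)
  have "a (n + 2) = a (n + 1) * p (n + 1) - a n * c (n + 1)"
    using assms(3)[of n] by simp
  then have "a (n + 2) \<in> A"
    using ge2 assms(4,5) by (simp only: Suc_eq_plus1) (intro A_intros; assumption)
  then show ?case by simp
qed (use assms in simp_all)

lemma A_xp: "xp k \<in> A"
  by (rule A_linear_recurrence[OF A_initial(1,2) pos.linear]) (auto simp: p_pos_def A_w A_z A_ymon)

lemma A_xn: "xn k \<in> A"
proof (rule A_linear_recurrence[OF A_initial(5) _ neg.linear])
  have "xn 1 = xn 0 * w - xp 0 * ymon 1 (vector [0, 0, 1])"
    by (simp add: xn_0_w)
  then show "xn 1 \<in> A"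
    by (simp only:) (intro A_intros A_initial A_w)
qed (auto simp: p_neg_def A_w A_z A_ymon)

lemma A_Xvar: "Xvar \<iota> k \<in> A"
proof (cases "k \<ge> 1")
  case True
  then show ?thesis using Xvar_pos[of "nat (k - 1)"] A_xp by simp
next
  case False
  then show ?thesis using Xvar_neg[of "nat (- k)"] A_xn by simp
qed

lemma A_u: "\<iota> (u_elt k) \<in> A"
proof -
  have u1: "\<iota> u1_elt \<in> A"
    using A_intros(2)[OF A_intros(2)[OF A_intros(1)[OF A_w A_z] A_ymon[of "-1" "vector [1, 0, 1]"]] A_ymon[of 1 "vector [0, 1, 0]"]]
    by (simp add: u1_relations)
  have V: "V \<in> A" unfolding V_def by (rule A_ymon)
  show ?thesis
  proof (induction k rule: less_induct)
    case (less k)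
    consider "k = 0" | "k = 1" | "k = 2" | i where "k = i + 3"
      by (metis add.commute add_2_eq_Suc' numeral_3_eq_3 One_nat_def Suc_1 add_Suc_right
          add_0_right not0_implies_Suc)
    then show ?case
    proof cases
      case 3
      have "(\<iota> u1_elt)\<^sup>2 - (V + V) \<in> A"
        by (intro A_intros A_power u1 V)
      then show ?thesis unfolding 3 u_elt_2 by (simp add: mult_2)
    next
      case (4 i)
      then have "\<iota> (u_elt (i + 2)) \<in> A" "\<iota> (u_elt (i + 1)) \<in> A"
        using less by auto
      then show ?thesis
        unfolding 4 u_elt_step using u1 V by (intro A_intros)
    qed (use u1 in \<open>simp_all add: quantum_cluster_algebra.one\<close>)
  qed
qed

section \<open>Matching indices and coefficients\<close>

lemma pos_identities:
  "xp k * xp (k + 2 * n + 3) = xp (k + n + 1) * xp (k + n + 2)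
     + ymon (-1) (pos_p k) * pos.T (n + 2) + ymon (-1) (pos_p (k + 1)) * pos.T (n + 1)"
  "xp k * xp (k + 2 * n) = xp (k + 2 * (n div 2)) * xp (k + 2 * ((n + 1) div 2))
     + ymon (-1) (pos_p k) * p_pos (k + 1) * pos.T n"
proof -
  show "xp k * xp (k + 2 * n + 3) = xp (k + n + 1) * xp (k + n + 2)
     + ymon (-1) (pos_p k) * pos.T (n + 2) + ymon (-1) (pos_p (k + 1)) * pos.T (n + 1)"
    using pos.odd_product[of k "n + 1"] by (simp add: eval_nat_numeral del: pos.T.simps)
  show "xp k * xp (k + 2 * n) = xp (k + 2 * (n div 2)) * xp (k + 2 * ((n + 1) div 2))
     + ymon (-1) (pos_p k) * p_pos (k + 1) * pos.T n"
    using pos.even_product[of k "n - 1"] by (cases n) (simp_all del: pos.T.simps(2,3))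
qed

lemma neg_identities:
  "xn k * xn (k + 2 * n + 3) = xn (k + n + 1) * xn (k + n + 2)
     + ymon 1 (neg_s k) * neg.T (n + 2) + ymon 1 (neg_s (k + 1)) * neg.T (n + 1)"
  "xn k * xn (k + 2 * n) = xn (k + 2 * (n div 2)) * xn (k + 2 * ((n + 1) div 2))
     + ymon 1 (neg_s k) * p_neg (k + 1) * neg.T n"
proof -
  show "xn k * xn (k + 2 * n + 3) = xn (k + n + 1) * xn (k + n + 2)
     + ymon 1 (neg_s k) * neg.T (n + 2) + ymon 1 (neg_s (k + 1)) * neg.T (n + 1)"
    using neg.odd_product[of k "n + 1"] by (simp add: eval_nat_numeral del: neg.T.simps)
  show "xn k * xn (k + 2 * n) = xn (k + 2 * (n div 2)) * xn (k + 2 * ((n + 1) div 2))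
     + ymon 1 (neg_s k) * p_neg (k + 1) * neg.T n"
    using neg.even_product[of k "n - 1"] by (cases n) (simp_all del: neg.T.simps(2,3))
qed

lemma Xvar_pos_identities:
  fixes k N :: nat
  assumes m: "m = int k + 1" and n: "n = int N"
  shows "Xvar \<iota> m * Xvar \<iota> (m + 2 * n + 3) = Xvar \<iota> (m + n + 1) * Xvar \<iota> (m + n + 2)
     + ymon (-1) (pos_p k) * pos.T (N + 2) + ymon (-1) (pos_p (k + 1)) * pos.T (N + 1)"
    and "Xvar \<iota> m * Xvar \<iota> (m + 2 * n) = Xvar \<iota> (m + 2 * (n div 2)) * Xvar \<iota> (m + 2 * ((n + 1) div 2))
     + ymon (-1) (pos_p k) * p_pos (k + 1) * pos.T N"
proof -
  have e: "m + 2 * n + 3 = int (k + 2 * N + 3) + 1" "m + n + 1 = int (k + N + 1) + 1" "m + n + 2 = int (k + N + 2) + 1"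
    "m + 2 * n = int (k + 2 * N) + 1"
    "m + 2 * (n div 2) = int (k + 2 * (N div 2)) + 1" "m + 2 * ((n + 1) div 2) = int (k + 2 * ((N + 1) div 2)) + 1"
    using m n by (simp_all add: zdiv_int)
  show "Xvar \<iota> m * Xvar \<iota> (m + 2 * n + 3) = Xvar \<iota> (m + n + 1) * Xvar \<iota> (m + n + 2)
     + ymon (-1) (pos_p k) * pos.T (N + 2) + ymon (-1) (pos_p (k + 1)) * pos.T (N + 1)"
    "Xvar \<iota> m * Xvar \<iota> (m + 2 * n) = Xvar \<iota> (m + 2 * (n div 2)) * Xvar \<iota> (m + 2 * ((n + 1) div 2))
     + ymon (-1) (pos_p k) * p_pos (k + 1) * pos.T N"
    unfolding e(1-3,5,6) unfolding e(4) unfolding m Xvar_pos by (rule pos_identities(1), rule pos_identities(2))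
qed

lemma Xvar_neg_identities:
  fixes k N :: nat
  assumes m: "m = int k" and n: "n = int N"
  shows "Xvar \<iota> (- m) * Xvar \<iota> (- (m + 2 * n + 3)) = Xvar \<iota> (- (m + n + 1)) * Xvar \<iota> (- (m + n + 2))
     + ymon 1 (neg_s k) * neg.T (N + 2) + ymon 1 (neg_s (k + 1)) * neg.T (N + 1)"
    and "Xvar \<iota> (- m) * Xvar \<iota> (- (m + 2 * n))
     = Xvar \<iota> (- (m + 2 * (n div 2))) * Xvar \<iota> (- (m + 2 * ((n + 1) div 2)))
     + ymon 1 (neg_s k) * p_neg (k + 1) * neg.T N"
proof -
  have e: "m + 2 * n + 3 = int (k + 2 * N + 3)" "m + n + 1 = int (k + N + 1)" "m + n + 2 = int (k + N + 2)"
    "m + 2 * n = int (k + 2 * N)"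
    "m + 2 * (n div 2) = int (k + 2 * (N div 2))" "m + 2 * ((n + 1) div 2) = int (k + 2 * ((N + 1) div 2))"
    using m n by (simp_all add: zdiv_int)
  show "Xvar \<iota> (- m) * Xvar \<iota> (- (m + 2 * n + 3)) = Xvar \<iota> (- (m + n + 1)) * Xvar \<iota> (- (m + n + 2))
     + ymon 1 (neg_s k) * neg.T (N + 2) + ymon 1 (neg_s (k + 1)) * neg.T (N + 1)"
    "Xvar \<iota> (- m) * Xvar \<iota> (- (m + 2 * n))
     = Xvar \<iota> (- (m + 2 * (n div 2))) * Xvar \<iota> (- (m + 2 * ((n + 1) div 2)))
     + ymon 1 (neg_s k) * p_neg (k + 1) * neg.T N"
    unfolding e(1-3,5,6) unfolding e(4) unfolding m Xvar_neg by (rule neg_identities(1), rule neg_identities(2))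
qed

lemmas eval_ymon = ymon_mult ymon_inject pos_p_def neg_s_def eval_3

text \<open>The exponent 5j collects 3j from normalising the power of \<open>Y\<close> and 2j from
  merging it with y_1. The remaining half power of q is supplied by the \<open>-1\<close> in the
  inner sum.\<close>

lemma pos_even_coefficients:
  fixes j :: nat
  shows "h powi (5 * int j) * yvar \<iota> 1 * Y powi int j * (ymon (-1) 0 * t) = ymon (-1) (pos_p (2 * j)) * t"
    and "h powi (5 * int j) * yvar \<iota> 1 * w * Y powi int j * (ymon (-1) 0 * t) = ymon (-1) (pos_p (2 * j)) * w * t"
proof -
  have b: "h powi (5 * int j) * yvar \<iota> 1 * (Y powi int j * ymon (-1) 0) = ymon (-1) (pos_p (2 * j))"
    unfolding h_powi Y_powi unfolding yvar_ymon by (simp add: eval_ymon algebra_simps)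
  have "Y powi int j * ymon (-1) 0 = ymon (-3 * int j - 1) (vector [int j, int j, int j])"
    unfolding h_powi Y_powi unfolding yvar_ymon by (simp add: eval_ymon)
  then have c: "w * (Y powi int j * ymon (-1) 0) = Y powi int j * ymon (-1) 0 * w"
    by (simp only:) (rule weight_commute[OF weight_w]; simp add: dot3_def)
  show "h powi (5 * int j) * yvar \<iota> 1 * Y powi int j * (ymon (-1) 0 * t) = ymon (-1) (pos_p (2 * j)) * t"
    unfolding b[symmetric] by (simp only: mult.assoc)
  have "h powi (5 * int j) * yvar \<iota> 1 * w * Y powi int j * (ymon (-1) 0 * t)
    = h powi (5 * int j) * yvar \<iota> 1 * (w * (Y powi int j * ymon (-1) 0)) * t"
    by (simp only: mult.assoc)
  also have "\<dots> = ymon (-1) (pos_p (2 * j)) * w * t"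
    unfolding b[symmetric] c by (simp only: mult.assoc)
  finally show "h powi (5 * int j) * yvar \<iota> 1 * w * Y powi int j * (ymon (-1) 0 * t) = ymon (-1) (pos_p (2 * j)) * w * t" .
qed

lemma pos_odd_coefficients:
  fixes j :: nat
  shows "h powi (5 * int j) * yvar \<iota> 1 * yvar \<iota> 2 * Y powi int j * (ymon 0 0 * t) = ymon (-1) (pos_p (2 * j + 1)) * t"
    and "h powi (5 * int j) * yvar \<iota> 1 * yvar \<iota> 2 * z * Y powi int j * (ymon 0 0 * t)
      = ymon (-1) (pos_p (2 * j + 1)) * z * t"
proof -
  have b: "h powi (5 * int j) * yvar \<iota> 1 * yvar \<iota> 2 * Y powi int j = ymon (-1) (pos_p (2 * j + 1))"
    unfolding h_powi Y_powi unfolding yvar_ymon by (simp add: eval_ymon algebra_simps)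
  have c: "z * Y powi int j = Y powi int j * z"
    unfolding Y_powi by (rule weight_commute[OF weight_z]) (simp add: dot3_def)
  show "h powi (5 * int j) * yvar \<iota> 1 * yvar \<iota> 2 * Y powi int j * (ymon 0 0 * t) = ymon (-1) (pos_p (2 * j + 1)) * t"
    unfolding b by (simp add: ymon_zero)
  have "h powi (5 * int j) * yvar \<iota> 1 * yvar \<iota> 2 * z * Y powi int j * (ymon 0 0 * t)
    = h powi (5 * int j) * yvar \<iota> 1 * yvar \<iota> 2 * (z * Y powi int j) * t"
    by (simp only: mult.assoc ymon_zero mult_1_left)
  also have "\<dots> = ymon (-1) (pos_p (2 * j + 1)) * z * t"
    unfolding b[symmetric] c by (simp only: mult.assoc)
  finally show "h powi (5 * int j) * yvar \<iota> 1 * yvar \<iota> 2 * z * Y powi int j * (ymon 0 0 * t)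
      = ymon (-1) (pos_p (2 * j + 1)) * z * t" .
qed

text \<open>Here merging y_2 y_3 or y_3 with the power of \<open>Y\<close> works against the
  normalisation, so that only 3j - 2j = j is left of the exponent that is 5j in the forward
  case.\<close>

lemma neg_odd_coefficients:
  fixes j :: nat
  shows "h powi int j * yvar \<iota> 2 * yvar \<iota> 3 * Y powi int j * (ymon 2 0 * t) = ymon 1 (neg_s (2 * j + 1)) * t"
    and "h powi int j * yvar \<iota> 3 * Y powi (int j + 1) * (ymon 2 0 * t) = ymon 1 (neg_s (2 * j + 2)) * t"
    and "h powi int j * w * yvar \<iota> 2 * yvar \<iota> 3 * Y powi int j * (ymon 2 0 * t)
      = ymon 1 (neg_s (2 * j + 1)) * w * t"
proof -
  have b: "yvar \<iota> 2 * yvar \<iota> 3 * Y powi int j * ymon 2 0 = ymon (1 - int j) (vector [int j, int j + 1, int j + 1])"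
    unfolding h_powi Y_powi unfolding yvar_ymon by (simp add: eval_ymon algebra_simps)
  have b': "h powi int j * ymon (1 - int j) (vector [int j, int j + 1, int j + 1]) = ymon 1 (neg_s (2 * j + 1))"
    unfolding h_powi Y_powi unfolding yvar_ymon by (simp add: eval_ymon)
  have d: "h powi int j * yvar \<iota> 3 * Y powi (int j + 1) * ymon 2 0 = ymon 1 (neg_s (2 * j + 2))"
    unfolding h_powi Y_powi unfolding yvar_ymon by (simp add: eval_ymon algebra_simps)
  have c: "w * ymon k (vector [int j, int j + 1, int j + 1]) = ymon k (vector [int j, int j + 1, int j + 1]) * w" for k
    by (rule weight_commute[OF weight_w]) (simp add: dot3_def)
  show "h powi int j * yvar \<iota> 2 * yvar \<iota> 3 * Y powi int j * (ymon 2 0 * t) = ymon 1 (neg_s (2 * j + 1)) * t"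
    unfolding b'[symmetric] b[symmetric] by (simp only: mult.assoc)
  show "h powi int j * yvar \<iota> 3 * Y powi (int j + 1) * (ymon 2 0 * t) = ymon 1 (neg_s (2 * j + 2)) * t"
    unfolding d[symmetric] by (simp only: mult.assoc)
  have "h powi int j * w * yvar \<iota> 2 * yvar \<iota> 3 * Y powi int j * (ymon 2 0 * t)
    = h powi int j * (w * (yvar \<iota> 2 * yvar \<iota> 3 * Y powi int j * ymon 2 0)) * t"
    by (simp only: mult.assoc)
  also have "\<dots> = ymon 1 (neg_s (2 * j + 1)) * w * t"
    unfolding b c b'[symmetric] by (simp only: mult.assoc)
  finally show "h powi int j * w * yvar \<iota> 2 * yvar \<iota> 3 * Y powi int j * (ymon 2 0 * t)
      = ymon 1 (neg_s (2 * j + 1)) * w * t" .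
qed

lemma neg_even_coefficients:
  fixes j :: nat
  shows "h powi (int j - 1) * yvar \<iota> 3 * Y powi int j * (ymon 2 0 * t) = ymon 1 (neg_s (2 * j)) * t"
    and "h powi (int j - 1) * yvar \<iota> 2 * yvar \<iota> 3 * Y powi int j * (ymon 3 0 * t) = ymon 1 (neg_s (2 * j + 1)) * t"
    and "h powi (int j - 1) * z * yvar \<iota> 3 * Y powi int j * (ymon 2 0 * t) = ymon 1 (neg_s (2 * j)) * z * t"
proof -
  have b: "yvar \<iota> 3 * Y powi int j * ymon 2 0 = ymon (2 - int j) (vector [int j, int j, int j + 1])"
    unfolding h_powi Y_powi unfolding yvar_ymon by (simp add: eval_ymon algebra_simps)
  have b': "h powi (int j - 1) * ymon (2 - int j) (vector [int j, int j, int j + 1]) = ymon 1 (neg_s (2 * j))"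
    unfolding h_powi Y_powi unfolding yvar_ymon by (simp add: eval_ymon)
  have d: "h powi (int j - 1) * yvar \<iota> 2 * yvar \<iota> 3 * Y powi int j * ymon 3 0 = ymon 1 (neg_s (2 * j + 1))"
    unfolding h_powi Y_powi unfolding yvar_ymon by (simp add: eval_ymon algebra_simps)
  have c: "z * ymon k (vector [int j, int j, int j + 1]) = ymon k (vector [int j, int j, int j + 1]) * z" for k
    by (rule weight_commute[OF weight_z]) (simp add: dot3_def)
  show "h powi (int j - 1) * yvar \<iota> 3 * Y powi int j * (ymon 2 0 * t) = ymon 1 (neg_s (2 * j)) * t"
    unfolding b'[symmetric] b[symmetric] by (simp only: mult.assoc)
  show "h powi (int j - 1) * yvar \<iota> 2 * yvar \<iota> 3 * Y powi int j * (ymon 3 0 * t) = ymon 1 (neg_s (2 * j + 1)) * t"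
    unfolding d[symmetric] by (simp only: mult.assoc)
  have "h powi (int j - 1) * z * yvar \<iota> 3 * Y powi int j * (ymon 2 0 * t)
    = h powi (int j - 1) * (z * (yvar \<iota> 3 * Y powi int j * ymon 2 0)) * t"
    by (simp only: mult.assoc)
  also have "\<dots> = ymon 1 (neg_s (2 * j)) * z * t"
    unfolding b c b'[symmetric] by (simp only: mult.assoc)
  finally show "h powi (int j - 1) * z * yvar \<iota> 3 * Y powi int j * (ymon 2 0 * t) = ymon 1 (neg_s (2 * j)) * z * t" .
qed

end

theorem theorem3p10:
  fixes \<iota> :: "qtorus \<Rightarrow> 'f::division_ring"
    and m n :: int
  assumes frac: "is_skew_fraction_field \<iota>"
    and m: "m \<ge> 0" and n: "n \<ge> 0"
  defines "X \<equiv> Xvar \<iota>" and "A \<equiv> quantum_cluster_algebra \<iota>"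
    and "h \<equiv> \<iota> qhalf"
    and "y1 \<equiv> yvar \<iota> 1" and "y2 \<equiv> yvar \<iota> 2" and "y3 \<equiv> yvar \<iota> 3"
    and "Y \<equiv> yvar \<iota> 1 * yvar \<iota> 2 * yvar \<iota> 3"
    and "w \<equiv> \<iota> w_elt" and "z \<equiv> \<iota> z_elt"
    and "u \<equiv> (\<lambda>k. \<iota> (u_elt (nat k)))"
  shows
    "(\<forall>k. X k \<in> A) \<and> w \<in> A \<and> z \<in> A \<and> (\<forall>k\<ge>0. u k \<in> A) \<and>
     (odd m \<longrightarrow>
        X m * X (m + 2*n + 3) = X (m + n + 1) * X (m + n + 2)
          + h powi ((5*m - 5) div 2) * y1 * Y powi ((m - 1) div 2)
            * (\<Sum>l = 0..n div 2.
                 (\<Sum>i = 0..l. h powi (2*i - 1 + 3*l)) * u (n - 2*l) * Y powi l)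
          + h powi ((5*m - 5) div 2) * y1 * y2 * Y powi ((m - 1) div 2)
            * (\<Sum>l = 0..(n - 1) div 2.
                 (\<Sum>i = 0..l. h powi (2*i + 3*l)) * u (n - 1 - 2*l) * Y powi l)
      \<and> X m * X (m + 2*n) = X (m + 2 * (n div 2)) * X (m + 2 * ((n + 1) div 2))
          + h powi ((5*m - 5) div 2) * y1 * w * Y powi ((m - 1) div 2)
            * (\<Sum>l = 0..(n - 2) div 2.
                 (\<Sum>i = 0..l. h powi (2*i - 1 + 3*l)) * u (n - 2 - 2*l) * Y powi l)
      \<and> X (-m) * X (-(m + 2*n + 3)) = X (-(m + n + 1)) * X (-(m + n + 2))
          + h powi ((m - 1) div 2) * y2 * y3 * Y powi ((m - 1) div 2)
            * (\<Sum>l = 0..n div 2.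
                 (\<Sum>i = 0..l. h powi (2*i + 2 + l)) * u (n - 2*l) * Y powi l)
          + h powi ((m - 1) div 2) * y3 * Y powi ((m + 1) div 2)
            * (\<Sum>l = 0..(n - 1) div 2.
                 (\<Sum>i = 0..l. h powi (2*i + 2 + l)) * u (n - 1 - 2*l) * Y powi l)
      \<and> X (-m) * X (-(m + 2*n)) = X (-(m + 2 * (n div 2))) * X (-(m + 2 * ((n + 1) div 2)))
          + h powi ((m - 1) div 2) * w * y2 * y3 * Y powi ((m - 1) div 2)
            * (\<Sum>l = 0..(n - 2) div 2.
                 (\<Sum>i = 0..l. h powi (2*i + 2 + l)) * u (n - 2 - 2*l) * Y powi l)) \<and>
     (even m \<longrightarrow>
        (m > 0 \<longrightarrow>
          X m * X (m + 2*n + 3) = X (m + n + 1) * X (m + n + 2)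
          + h powi ((5*m - 10) div 2) * y1 * y2 * Y powi ((m - 2) div 2)
            * (\<Sum>l = 0..n div 2.
                 (\<Sum>i = 0..l. h powi (2*i + 3*l)) * u (n - 2*l) * Y powi l)
          + h powi (5*m div 2) * y1 * Y powi (m div 2)
            * (\<Sum>l = 0..(n - 1) div 2.
                 (\<Sum>i = 0..l. h powi (2*i - 1 + 3*l)) * u (n - 1 - 2*l) * Y powi l))
      \<and> (m > 0 \<longrightarrow>
          X m * X (m + 2*n) = X (m + 2 * (n div 2)) * X (m + 2 * ((n + 1) div 2))
          + h powi ((5*m - 10) div 2) * y1 * y2 * z * Y powi ((m - 2) div 2)
            * (\<Sum>l = 0..(n - 2) div 2.
                 (\<Sum>i = 0..l. h powi (2*i + 3*l)) * u (n - 2 - 2*l) * Y powi l))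
      \<and> X (-m) * X (-(m + 2*n + 3)) = X (-(m + n + 1)) * X (-(m + n + 2))
          + h powi ((m - 2) div 2) * y3 * Y powi (m div 2)
            * (\<Sum>l = 0..n div 2.
                 (\<Sum>i = 0..l. h powi (2*i + 2 + l)) * u (n - 2*l) * Y powi l)
          + h powi ((m - 2) div 2) * y2 * y3 * Y powi (m div 2)
            * (\<Sum>l = 0..(n - 1) div 2.
                 (\<Sum>i = 0..l. h powi (2*i + 3 + l)) * u (n - 1 - 2*l) * Y powi l)
      \<and> X (-m) * X (-(m + 2*n)) = X (-(m + 2 * (n div 2))) * X (-(m + 2 * ((n + 1) div 2)))
          + h powi ((m - 2) div 2) * z * y3 * Y powi (m div 2)
            * (\<Sum>l = 0..(n - 2) div 2.
                 (\<Sum>i = 0..l. h powi (2*i + 2 + l)) * u (n - 2 - 2*l) * Y powi l))"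
proof -
  interpret skew_fraction_field \<iota>
    by unfold_locales (rule frac)
  obtain N where N: "n = int N"
    using n by (metis nonneg_int_cases)
  \<comment> \<open>Each upper summation parameter is written as \<open>t - 2\<close>, matching the
    index shift of \<open>T\<close>; this covers the negative values of \<open>n - 1\<close> and
    \<open>n - 2\<close>.\<close>
  have sums: "n = int (N + 2) - 2" "n - 1 = int (N + 1) - 2" "n - 2 = int N - 2"
    using N by simp_all
  have pos_sums:
    "(\<Sum>l = 0..n div 2. (\<Sum>i = 0..l. h powi (2*i - 1 + 3*l)) * u (n - 2*l) * Y powi l) = ymon (-1) 0 * pos.T (N + 2)"
    "(\<Sum>l = 0..(n - 1) div 2. (\<Sum>i = 0..l. h powi (2*i + 3*l)) * u (n - 1 - 2*l) * Y powi l) = ymon 0 0 * pos.T (N + 1)"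
    "(\<Sum>l = 0..(n - 2) div 2. (\<Sum>i = 0..l. h powi (2*i - 1 + 3*l)) * u (n - 2 - 2*l) * Y powi l) = ymon (-1) 0 * pos.T N"
    "(\<Sum>l = 0..n div 2. (\<Sum>i = 0..l. h powi (2*i + 3*l)) * u (n - 2*l) * Y powi l) = ymon 0 0 * pos.T (N + 2)"
    "(\<Sum>l = 0..(n - 1) div 2. (\<Sum>i = 0..l. h powi (2*i - 1 + 3*l)) * u (n - 1 - 2*l) * Y powi l) = ymon (-1) 0 * pos.T (N + 1)"
    "(\<Sum>l = 0..(n - 2) div 2. (\<Sum>i = 0..l. h powi (2*i + 3*l)) * u (n - 2 - 2*l) * Y powi l) = ymon 0 0 * pos.T N"
    unfolding h_def u_def Y_def by (rule pos_sum; use sums in simp)+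
  have neg_sums:
    "(\<Sum>l = 0..n div 2. (\<Sum>i = 0..l. h powi (2*i + 2 + l)) * u (n - 2*l) * Y powi l) = ymon 2 0 * neg.T (N + 2)"
    "(\<Sum>l = 0..(n - 1) div 2. (\<Sum>i = 0..l. h powi (2*i + 2 + l)) * u (n - 1 - 2*l) * Y powi l) = ymon 2 0 * neg.T (N + 1)"
    "(\<Sum>l = 0..(n - 2) div 2. (\<Sum>i = 0..l. h powi (2*i + 2 + l)) * u (n - 2 - 2*l) * Y powi l) = ymon 2 0 * neg.T N"
    "(\<Sum>l = 0..(n - 1) div 2. (\<Sum>i = 0..l. h powi (2*i + 3 + l)) * u (n - 1 - 2*l) * Y powi l) = ymon 3 0 * neg.T (N + 1)"
    unfolding h_def u_def Y_def by (rule neg_sum; use sums in simp)+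
  have mem: "(\<forall>k. X k \<in> A) \<and> w \<in> A \<and> z \<in> A \<and> (\<forall>k\<ge>0. u k \<in> A)"
    unfolding X_def A_def w_def z_def u_def using A_Xvar A_w A_z A_u by blast
  note defs = X_def h_def y1_def y2_def y3_def Y_def w_def z_def
  show ?thesis
    (is "_ \<and> _ \<and> _ \<and> _ \<and> (odd m \<longrightarrow> ?odd) \<and> (even m \<longrightarrow> (m > 0 \<longrightarrow> ?pos1) \<and> (m > 0 \<longrightarrow> ?pos2) \<and> ?neg1 \<and> ?neg2)")
  proof -
    have ?odd if parity: "odd m"
    proof -
      obtain i where "m = 2 * i + 1"
        using parity by (elim oddE)
      moreover define J where "J = nat i"
      ultimately have J: "m = 2 * int J + 1"
        using m by simp
      have e: "(5 * m - 5) div 2 = 5 * int J" "(m - 1) div 2 = int J" "(m + 1) div 2 = int J + 1"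
        using J by auto
      \<comment> \<open>The same odd \<open>m\<close> is an even position of \<open>xp\<close> but
        an odd position of \<open>xn\<close>.\<close>
      have k: "m = int (2 * J) + 1" "m = int (2 * J + 1)" "2 * J + 1 + 1 = 2 * J + 2"
        using J by simp_all
      have p: "p_pos (2 * J + 1) = \<iota> w_elt" "p_neg (2 * J + 2) = \<iota> w_elt"
        by (simp_all add: p_pos_def p_neg_def)
      show ?thesis
        unfolding pos_sums neg_sums e unfolding defs
          pos_even_coefficients pos_odd_coefficients neg_odd_coefficients
        using Xvar_pos_identities[OF k(1) N, unfolded p] Xvar_neg_identities[OF k(2) N, unfolded k(3) p]
        by (simp only:)
    qed
    moreover have "(m > 0 \<longrightarrow> ?pos1) \<and> (m > 0 \<longrightarrow> ?pos2)" if parity: "even m"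
    proof (cases "m > 0")
      case True
      obtain i where "m = 2 * i"
        using parity by (elim evenE)
      \<comment> \<open>X_m with \<open>m = 2 * i\<close> is at position
        \<open>2 * (i - 1) + 1\<close> of \<open>xp\<close>; this uses \<open>m > 0\<close>, since
        X_0 belongs to the backward sequence.\<close>
      moreover define J where "J = nat (i - 1)"
      ultimately have J: "m = 2 * int J + 2"
        using True by simp
      have e: "(5 * m - 10) div 2 = 5 * int J" "(m - 2) div 2 = int J" "5 * m div 2 = 5 * int (J + 1)" "m div 2 = int (J + 1)"
        using J by auto
      have k: "m = int (2 * J + 1) + 1" "2 * J + 1 + 1 = 2 * (J + 1)"
        using J by simp_all
      have p: "p_pos (2 * (J + 1)) = \<iota> z_elt"
        by (simp add: p_pos_def)
      have ?pos1 ?pos2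
        unfolding pos_sums e unfolding defs pos_even_coefficients pos_odd_coefficients
        using Xvar_pos_identities[OF k(1) N, unfolded k(2) p] by (simp_all only:)
      then show ?thesis by blast
    qed simp
    moreover have "?neg1 \<and> ?neg2" if parity: "even m"
    proof -
      obtain i where "m = 2 * i"
        using parity by (elim evenE)
      moreover define J where "J = nat i"
      ultimately have J: "m = 2 * int J"
        using m by simp
      have e: "(m - 2) div 2 = int J - 1" "m div 2 = int J"
        using J by auto
      have k: "m = int (2 * J)"
        using J by simp
      have p: "p_neg (2 * J + 1) = \<iota> z_elt"
        by (simp add: p_neg_def)
      show ?thesis
        unfolding neg_sums e unfolding defs neg_even_coefficients
        using Xvar_neg_identities[OF k N, unfolded p] by (simp only:)
    qed
    ultimately show ?thesis
      using mem by blast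
  qed
qed

end
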